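(* Let $(X_t)_{t\ge 0}$ be a regular non-explosive continuous-time Markov chain on the countable metric space $(E,d)$ with transition rates $(Q(x,y))_{x\ne y}$. Assume that the jumps of $(X_t)_{t\ge0}$ are bounded by $b>0$ and that its angle bracket is bounded by $V^2>0$. Suppose moreover that its $d$-Wasserstein curvature is bounded below by $K\in\mathbb{R}$. Let $f\in \mathrm{Lip}_d(E)$, and define $C_{t,K}:=\sup_{0\le s\le t}e^{-K(t-s)}$ and $M_{t,K}:=(1-e^{-2Kt})/(2K)$ (with $M_{t,K}=t$ if $K=0$). Then for any $x\in E$, any $t>0$ and any $y>0$, $$\mathbb{P}_x\big(f(X_t)-\mathbb{E}_x[f(X_t)]\ge y\big)\le \exp\left(-\frac{y}{2bC_{t,K}\|f\|_{\mathrm{Lip}_d}}\log\left(1+\frac{bC_{t,K}\,y}{M_{t,K}V^2\|f\|_{\mathrm{Lip}_d}}\right)\right).$$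
   Context: $E$ is a countable set with a metric $d$ different from the trivial metric $\varrho(x,y)=1_{x\neq y}$. $\mathrm{Lip}_d(E)$ is the space of functions $f:E\to\mathbb{R}$ with $\|f\|_{\mathrm{Lip}_d}:=\sup_{x\ne y}|f(x)-f(y)|/d(x,y)<+\infty$. The chain $(X_t)_{t\ge0}$ is an $E$-valued regular (its rates are stable and conservative and determine the process uniquely) non-explosive continuous-time Markov chain with generator $\mathcal{L}f(x)=\sum_{y\in E}(f(y)-f(x))Q(x,y)$ for bounded $f$, where $Q(x,y)\ge0$ for $x\neq y$. $\mathbb{P}_x,\mathbb{E}_x$ refer to the chain started at $X_0=x$, and $P_tf(x)=\mathbb{E}_x[f(X_t)]=\sum_{y\in E}f(y)P_t(x,y)$ is its semigroup. Jumps bounded by $b$: $\sup_{t>0}d(X_{t-},X_t)\le b$. Angle bracket bounded by $V^2$: $\sup_{x\in E}\sum_{y\in E}d(x,y)^2Q(x,y)\le V^2$. $d$-Wasserstein curvature bounded below by $K\in\mathbb{R}$: it is assumed that $P_t(x,\cdot)\in\mathscr{P}_1(E)$ for some $x\in E$, where $\mathscr{P}_1(E)$ is the set of probability measures $\mu$ on $E$ with $\sum_{y\in E}d(y,z)\mu(y)<+\infty$ for some $z\in E$ (so that the semigroup is well defined on $\mathrm{Lip}_d(E)$), and that $\|P_tf\|_{\mathrm{Lip}_d}\le e^{-Kt}\|f\|_{\mathrm{Lip}_d}$ for every $f\in\mathrm{Lip}_d(E)$ and every $t>0$. *)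

theory Defs
  imports "HOL-Probability.Probability" "HOL-Analysis.Abstract_Metric_Spaces"
begin

section \<open>Lipschitz functions and measures with finite first moment\<close>

text \<open>
  The state space is a countable type \<open>'a\<close>; the metric is an explicit function \<open>d\<close> with
  \<open>Metric_space UNIV d\<close>. The \<open>\<sigma>\<close>-algebra on states is always the full power set.
\<close>

definition lip_quotients :: "('a \<Rightarrow> 'a \<Rightarrow> real) \<Rightarrow> ('a \<Rightarrow> real) \<Rightarrow> real set" where
  "lip_quotients d f = {\<bar>f x - f y\<bar> / d x y | x y. x \<noteq> y}"

definition Lip :: "('a \<Rightarrow> 'a \<Rightarrow> real) \<Rightarrow> ('a \<Rightarrow> real) set" where
  "Lip d = {f. bdd_above (lip_quotients d f)}"

text \<open>The real supremum below is meaningful for \<open>f \<in> Lip d\<close> and at least two states.\<close>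

definition lip_norm :: "('a \<Rightarrow> 'a \<Rightarrow> real) \<Rightarrow> ('a \<Rightarrow> real) \<Rightarrow> real" where
  "lip_norm d f = Sup (lip_quotients d f)"

definition P1 :: "('a \<Rightarrow> 'a \<Rightarrow> real) \<Rightarrow> 'a measure set" where
  "P1 d = {\<mu>. prob_space \<mu> \<and> sets \<mu> = UNIV \<and>
             (\<exists>z. (\<lambda>y. d y z * measure \<mu> {y}) summable_on UNIV)}"


section \<open>Regular transition rates\<close>

text \<open>
  Only the off-diagonal entries of a rate matrix \<open>Q\<close> are ever used. Conservativity means that
  the total rate of leaving \<open>x\<close> is the sum of the off-diagonal rates.
\<close>

definition exit_rate :: "('a \<Rightarrow> 'a \<Rightarrow> real) \<Rightarrow> 'a \<Rightarrow> real" where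
  "exit_rate Q x = (\<Sum>\<^sub>\<infinity>y\<in>UNIV - {x}. Q x y)"

definition generator :: "('a \<Rightarrow> 'a \<Rightarrow> real) \<Rightarrow> ('a \<Rightarrow> real) \<Rightarrow> 'a \<Rightarrow> real" where
  "generator Q f x = (\<Sum>\<^sub>\<infinity>y. (f y - f x) * Q x y)"

text \<open>Standard, possibly sub-Markovian, transition functions.\<close>

definition transition_function :: "(real \<Rightarrow> 'a \<Rightarrow> 'a \<Rightarrow> real) \<Rightarrow> bool" where
  "transition_function p \<longleftrightarrow>
     (\<forall>t\<ge>0. \<forall>x y. 0 \<le> p t x y) \<and>
     (\<forall>t\<ge>0. \<forall>x. p t x summable_on UNIV \<and> (\<Sum>\<^sub>\<infinity>y. p t x y) \<le> 1) \<and>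
     (\<forall>x y. p 0 x y = of_bool (x = y)) \<and>
     (\<forall>s\<ge>0. \<forall>t\<ge>0. \<forall>x z. p (s + t) x z = (\<Sum>\<^sub>\<infinity>y. p s x y * p t y z)) \<and>
     (\<forall>x y. ((\<lambda>t. p t x y) \<longlongrightarrow> of_bool (x = y)) (at_right 0))"

definition has_rates :: "(real \<Rightarrow> 'a \<Rightarrow> 'a \<Rightarrow> real) \<Rightarrow> ('a \<Rightarrow> 'a \<Rightarrow> real) \<Rightarrow> bool" where
  "has_rates p Q \<longleftrightarrow>
     (\<forall>x y. ((\<lambda>t. (p t x y - of_bool (x = y)) / t)
               \<longlongrightarrow> (if x = y then - exit_rate Q x else Q x y)) (at_right 0))"

definition regular_rates :: "('a \<Rightarrow> 'a \<Rightarrow> real) \<Rightarrow> bool" where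
  "regular_rates Q \<longleftrightarrow>
     (\<forall>x y. x \<noteq> y \<longrightarrow> 0 \<le> Q x y) \<and>
     (\<forall>x. Q x summable_on (UNIV - {x})) \<and>
     (\<forall>p p'. transition_function p \<and> has_rates p Q \<and> transition_function p' \<and> has_rates p' Q
        \<longrightarrow> (\<forall>t\<ge>0. p t = p' t))"


section \<open>Continuous-time Markov chains\<close>

text \<open>
  \<open>M x\<close> is the law \<open>\<bbbP>\<^sub>x\<close> on the sample space, \<open>X t\<close> the state at time \<open>t\<close>; only times \<open>t \<ge> 0\<close>
  matter.
\<close>

definition trans_law :: "('a \<Rightarrow> 'w measure) \<Rightarrow> (real \<Rightarrow> 'w \<Rightarrow> 'a) \<Rightarrow> real \<Rightarrow> 'a \<Rightarrow> 'a measure" where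
  "trans_law M X t x = distr (M x) (count_space UNIV) (X t)"

definition semigroup_op ::
    "('a \<Rightarrow> 'w measure) \<Rightarrow> (real \<Rightarrow> 'w \<Rightarrow> 'a) \<Rightarrow> real \<Rightarrow> ('a \<Rightarrow> real) \<Rightarrow> 'a \<Rightarrow> real" where
  "semigroup_op M X t f x = (LINT \<omega>|M x. f (X t \<omega>))"

text \<open>
  Left limits and right-continuity are taken in the discrete topology: the paths are step
  functions. Right-continuity together with the existence of left limits in the state space at
  every finite time forces finitely many jumps in each bounded time interval, that is,
  non-explosion.
\<close>

definition step_path :: "(real \<Rightarrow> 'a) \<Rightarrow> bool" where
  "step_path w \<longleftrightarrow>
     (\<forall>t\<ge>0. \<forall>\<^sub>F s in at_right t. w s = w t) \<and>
     (\<forall>t>0. \<exists>y. \<forall>\<^sub>F s in at_left t. w s = y)"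

definition left_limit :: "(real \<Rightarrow> 'a) \<Rightarrow> real \<Rightarrow> 'a" where
  "left_limit w t = (THE y. \<forall>\<^sub>F s in at_left t. w s = y)"

locale regular_nonexplosive_chain =
  fixes M :: "'a::countable \<Rightarrow> 'w measure"
    and X :: "real \<Rightarrow> 'w \<Rightarrow> 'a"
    and Q :: "'a \<Rightarrow> 'a \<Rightarrow> real"
  assumes regular: "regular_rates Q"
    and prob_space_M: "prob_space (M x)"
    and measurable_X: "0 \<le> t \<Longrightarrow> X t \<in> measurable (M x) (count_space UNIV)"
    and initial: "AE \<omega> in M x. X 0 \<omega> = x"
    and nonexplosive: "AE \<omega> in M x. step_path (\<lambda>t. X t \<omega>)"
    and markov: "\<And>J u. \<lbrakk>0 \<le> s; 0 \<le> t; finite J; J \<subseteq> {0..s}\<rbrakk> \<Longrightarrow>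
      \<P>(\<omega> in M x. X (s + t) \<omega> = z \<and> X s \<omega> = y \<and> (\<forall>r\<in>J. X r \<omega> = u r)) =
      \<P>(\<omega> in M x. X s \<omega> = y \<and> (\<forall>r\<in>J. X r \<omega> = u r)) * \<P>(\<omega> in M y. X t \<omega> = z)"
    and has_generator: "bounded (range f) \<Longrightarrow>
      ((\<lambda>t. (semigroup_op M X t f x - f x) / t) \<longlongrightarrow> generator Q f x) (at_right 0)"

definition jumps_bounded ::
    "('a \<Rightarrow> 'a \<Rightarrow> real) \<Rightarrow> ('a \<Rightarrow> 'w measure) \<Rightarrow> (real \<Rightarrow> 'w \<Rightarrow> 'a) \<Rightarrow> real \<Rightarrow> bool" where
  "jumps_bounded d M X b \<longleftrightarrow>
     (\<forall>x. AE \<omega> in M x. \<forall>t>0. d (left_limit (\<lambda>s. X s \<omega>) t) (X t \<omega>) \<le> b)"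

text \<open>The supremum and the sum are taken in \<open>[0, \<infinity>]\<close>; the term \<open>y = x\<close> vanishes.\<close>

definition angle_bracket_bounded ::
    "('a \<Rightarrow> 'a \<Rightarrow> real) \<Rightarrow> ('a \<Rightarrow> 'a \<Rightarrow> real) \<Rightarrow> real \<Rightarrow> bool" where
  "angle_bracket_bounded d Q V \<longleftrightarrow>
     (SUP x. \<integral>\<^sup>+y. ennreal ((d x y)\<^sup>2 * Q x y) \<partial>count_space UNIV) \<le> ennreal (V\<^sup>2)"

text \<open>
  Bochner integrals of non-integrable functions are \<open>0\<close>, but this junk value does not affect the
  meaning: by the moment condition at one state, the contraction applied to the bounded
  Lipschitz functions \<open>min n (d z \<cdot>)\<close>, and monotone convergence, \<open>f \<circ> X t\<close> is
  integrable under every \<open>M x\<close> for all \<open>f \<in> Lip d\<close>.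
\<close>

definition wasserstein_curvature_ge ::
    "('a \<Rightarrow> 'a \<Rightarrow> real) \<Rightarrow> ('a \<Rightarrow> 'w measure) \<Rightarrow> (real \<Rightarrow> 'w \<Rightarrow> 'a) \<Rightarrow> real \<Rightarrow> bool" where
  "wasserstein_curvature_ge d M X K \<longleftrightarrow>
     (\<forall>t>0. \<exists>x. trans_law M X t x \<in> P1 d) \<and>
     (\<forall>f\<in>Lip d. \<forall>t>0. semigroup_op M X t f \<in> Lip d \<and>
        lip_norm d (semigroup_op M X t f) \<le> exp (- K * t) * lip_norm d f)"

definition C_const :: "real \<Rightarrow> real \<Rightarrow> real" where
  "C_const t K = (SUP s\<in>{0..t}. exp (- K * (t - s)))"

definition M_const :: "real \<Rightarrow> real \<Rightarrow> real" where
  "M_const t K = (if K = 0 then t else (1 - exp (- 2 * K * t)) / (2 * K))"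

text \<open>
  The right-hand side of the deviation inequality, with \<open>L\<close> the Lipschitz seminorm. For \<open>L = 0\<close>
  the formula is read as its limit \<open>0\<close> for \<open>L \<rightarrow> 0\<close>, and not as the value \<open>1\<close> that would result
  from the convention \<open>y / 0 = 0\<close>.
\<close>

definition deviation_bound :: "real \<Rightarrow> real \<Rightarrow> real \<Rightarrow> real \<Rightarrow> real \<Rightarrow> real \<Rightarrow> real" where
  "deviation_bound b V C m L y =
     (if L = 0 then 0
      else exp (- (y / (2 * b * C * L)) * ln (1 + b * C * y / (m * V\<^sup>2 * L))))"

end

theory Submission
  imports Defs
begin

text \<open>
  For bounded Lipschitz \<open>f\<close> put \<open>u\<^sub>r = P\<^sub>r f\<close>. By the curvature bound \<open>u\<^sub>r\<close> has Lipschitz constant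
  \<open>exp (- K r) L\<close>, so a short step of the chain of length \<open>h\<close> satisfies
  \<open>P\<^sub>h (exp u\<^sub>r) \<le> exp (u\<^bsub>r+h\<^esub> + h (c exp (- 2 K r) + o(1)))\<close>: expand \<open>exp\<close> to second order, and use that the
  possible jumps have length at most \<open>b\<close> and that the angle bracket is bounded. Multiplying such steps
  along the skeleton \<open>X\<^sub>0, X\<^sub>h, X\<^bsub>2h\<^esub>, \<dots>\<close> killed on leaving a finite set, where the \<open>o(1)\<close> is uniform, and
  letting \<open>h \<rightarrow> 0\<close> and then the finite set grow (paths visit finitely many states up to time \<open>t\<close>) bounds
  the exponential moments of \<open>f (X\<^sub>t)\<close>. This needs no forward equation, so unbounded exit rates do no
  harm. Truncation of \<open>f\<close>, Markov's inequality and Bennett's choice of the exponent conclude.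
\<close>

section \<open>Real inequalities\<close>

lemma exp_remainder_sums:
  "(\<lambda>n. x ^ (n + 2) / fact (n + 2)) sums (exp x - 1 - x)" for x :: real
  using sums_split_initial_segment[OF exp_converges[of x], of 2]
  by (simp add: eval_nat_numeral divide_inverse mult.commute diff_diff_eq)

text \<open>Every term of the series of \<open>exp v - 1 - v\<close> carries a factor
  \<open>v\<^sup>2\<close>, and the remaining power \<open>v ^ n\<close> is at most
  \<open>B ^ n\<close> whatever the sign of \<open>v\<close>. Comparing the series term by term
  gives the claim.\<close>

lemma exp_remainder_le:
  fixes v B :: real
  assumes "\<bar>v\<bar> \<le> B" and "0 < B"
  shows "exp v - 1 - v \<le> v\<^sup>2 * ((exp B - 1 - B) / B\<^sup>2)"
proof -
  have term_le: "v ^ (n + 2) / fact (n + 2) \<le> v\<^sup>2 / B\<^sup>2 * (B ^ (n + 2) / fact (n + 2))" for n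
  proof -
    have "v ^ n \<le> \<bar>v\<bar> ^ n"
      by (metis abs_ge_self power_abs)
    also have "\<dots> \<le> B ^ n"
      using assms by (intro power_mono) auto
    finally have "v\<^sup>2 * v ^ n \<le> v\<^sup>2 * B ^ n"
      by (simp add: mult_left_mono)
    then have "v ^ (n + 2) \<le> v\<^sup>2 / B\<^sup>2 * B ^ (n + 2)"
      using assms by (simp add: power_add power2_eq_square mult_ac)
    from divide_right_mono[OF this, of "fact (n + 2)"] show ?thesis
      by simp
  qed
  have "exp v - 1 - v \<le> v\<^sup>2 / B\<^sup>2 * (exp B - 1 - B)"
    by (rule sums_le[OF term_le exp_remainder_sums sums_mult[OF exp_remainder_sums]])
  then show ?thesis
    by simp
qed

lemma exp_remainder_nonneg: "0 \<le> exp v - 1 - v" for v :: real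
  using exp_ge_add_one_self[of v] by linarith

text \<open>The difference of the two sides vanishes at 0 and has a nonnegative derivative. This is
  what weakens the sharp Bennett exponent \<open>(1 + u) * ln (1 + u) - u\<close> to
  \<open>u / 2 * ln (1 + u)\<close>.\<close>

lemma ln_one_plus_ge_rational:
  fixes u :: real
  assumes "0 \<le> u"
  shows "u \<le> (1 + u / 2) * ln (1 + u)"
proof -
  let ?g = "\<lambda>u::real. (1 + u / 2) * ln (1 + u) - u"
  have "?g 0 \<le> ?g u"
  proof (rule DERIV_nonneg_imp_nondecreasing[OF assms])
    fix s :: real
    assume s: "0 \<le> s" "s \<le> u"
    have "(?g has_real_derivative (1 / 2 * ln (1 + s) + (1 + s / 2) / (1 + s) - 1)) (at s)"
      using s by (auto intro!: derivative_eq_intros simp: divide_simps) (simp add: algebra_simps)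
    moreover have "0 \<le> 1 / 2 * ln (1 + s) + (1 + s / 2) / (1 + s) - 1"
    proof -
      \<comment> \<open>The derivative equals \<open>(ln (1 + s) - s / (1 + s)) / 2\<close>; its
        sign comes from \<open>ln z <= z - 1\<close> at \<open>z = 1 / (1 + s)\<close>.\<close>
      have "ln (1 / (1 + s)) \<le> 1 / (1 + s) - 1"
        using s by (intro ln_le_minus_one) auto
      then have "s / (1 + s) \<le> ln (1 + s)"
        using s by (simp add: ln_div field_simps)
      moreover have "(1 + s / 2) / (1 + s) - 1 = - (1 / 2) * (s / (1 + s))"
        using s by (simp add: field_simps)
      ultimately show ?thesis
        by linarith
    qed
    ultimately show "\<exists>y. (?g has_real_derivative y) (at s) \<and> 0 \<le> y"
      by blast
  qed
  then show ?thesis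
    by simp
qed

text \<open>The choice \<open>\<lambda> = ln (1 + B y / v) / B\<close> is the optimal one in Bennett's inequality.\<close>

lemma bennett_exponent:
  fixes B v y :: real
  assumes B: "0 < B" and v: "0 < v" and y: "0 < y"
  defines "l \<equiv> ln (1 + B * y / v) / B"
  shows "(exp (l * B) - 1 - l * B) / B\<^sup>2 * v - l * y \<le> - (y / (2 * B)) * ln (1 + B * y / v)"
proof -
  define u where "u = B * y / v"
  have u: "0 < u"
    using assms by (simp add: u_def)
  have lB: "l * B = ln (1 + u)"
    using B by (simp add: l_def u_def)
  have e: "exp (l * B) = 1 + u"
    using u by (simp add: lB)
  have yu: "y = u * v / B"
    using B v by (simp add: u_def)
  have "(exp (l * B) - 1 - l * B) / B\<^sup>2 * v - l * y = (v / B\<^sup>2) * (u - ln (1 + u) - u * ln (1 + u))"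
    unfolding e unfolding lB using B by (simp add: l_def u_def[symmetric] yu power2_eq_square field_simps)
  also have "\<dots> \<le> (v / B\<^sup>2) * (- (u / 2) * ln (1 + u))"
    using ln_one_plus_ge_rational[of u] u v
    by (intro mult_left_mono) (auto simp: algebra_simps)
  also have "\<dots> = - (y / (2 * B)) * ln (1 + B * y / v)"
    using B v by (simp add: u_def[symmetric] yu power2_eq_square field_simps)
  finally show ?thesis .
qed

text \<open>These are left Riemann sums of the integral of \<open>exp (- 2 * K * r)\<close> over
  \<open>[0, t]\<close>. For \<open>K\<close> nonzero they are geometric sums, so the limit follows
  from the derivative of \<open>exp\<close> at 0.\<close>

lemma geometric_riemann_sum:
  fixes K t :: real
  assumes "0 < t"
  shows "(\<lambda>n::nat. \<Sum>k<n. t / real n * exp (- 2 * K * (real k * (t / real n)))) \<longlonglongrightarrow> M_const t K"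
proof (cases "K = 0")
  case True
  have "(\<lambda>n::nat. \<Sum>k<n. t / real n * exp (- 2 * K * (real k * (t / real n)))) \<longlonglongrightarrow> t"
    by (rule tendsto_eventually, rule eventually_sequentiallyI[of 1]) (simp add: True)
  then show ?thesis
    by (simp add: M_const_def True)
next
  case False
  define g where "g n = t / real n * (1 - exp (- 2 * K * t)) / (1 - exp (- 2 * K * (t / real n)))" for n :: nat
  have "\<forall>\<^sub>F n in sequentially. g n = (\<Sum>k<n. t / real n * exp (- 2 * K * (real k * (t / real n))))"
  proof (rule eventually_sequentiallyI[of 1])
    fix n :: nat
    assume n: "1 \<le> n"
    define q where "q = exp (- 2 * K * (t / n))"
    have "q \<noteq> 1"
      using n False assms by (simp add: q_def)
    moreover have "q ^ k = exp (- 2 * K * (k * (t / n)))" for k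
      by (simp add: q_def exp_of_nat_mult[symmetric] algebra_simps)
    moreover have "q ^ n = exp (- 2 * K * t)"
      using n by (simp add: q_def exp_of_nat_mult[symmetric])
    ultimately have "(\<Sum>k<n. t / real n * exp (- 2 * K * (real k * (t / real n))))
        = t / real n * ((1 - exp (- 2 * K * t)) / (1 - q))"
      by (metis (no_types, lifting) sum.cong sum_distrib_left sum_gp_strict)
    then show "g n = (\<Sum>k<n. t / real n * exp (- 2 * K * (real k * (t / real n))))"
      by (simp add: g_def q_def)
  qed
  moreover have "g \<longlonglongrightarrow> (1 - exp (- 2 * K * t)) / (2 * K)"
  proof -
    have 1: "(\<lambda>n. - 2 * K * (t / real n)) \<longlonglongrightarrow> 0"
      by (intro tendsto_mult_right_zero lim_const_over_n)
    have 2: "\<forall>\<^sub>F n in sequentially. - 2 * K * (t / real n) \<noteq> 0"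
      using False assms by (intro eventually_sequentiallyI[of 1]) auto
    have "((\<lambda>x::real. (exp x - 1) / x) \<longlongrightarrow> 1) (at 0)"
      using DERIV_exp[of 0] by (simp add: DERIV_def)
    from filterlim_compose[OF this filterlim_atI[OF 1 2]]
    have "(\<lambda>n. (exp (- 2 * K * (t / real n)) - 1) / (- 2 * K * (t / real n))) \<longlonglongrightarrow> 1" .
    from tendsto_divide[OF tendsto_const this, of "(1 - exp (- 2 * K * t)) / (2 * K)"]
    have "(\<lambda>n. (1 - exp (- 2 * K * t)) / (2 * K) /
        ((exp (- 2 * K * (t / real n)) - 1) / (- 2 * K * (t / real n)))) \<longlonglongrightarrow>
        (1 - exp (- 2 * K * t)) / (2 * K)"
      by simp
    then show ?thesis
    proof (rule Lim_transform_eventually)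
      show "\<forall>\<^sub>F n in sequentially. (1 - exp (- 2 * K * t)) / (2 * K) /
        ((exp (- 2 * K * (t / real n)) - 1) / (- 2 * K * (t / real n))) = g n"
      proof (rule eventually_sequentiallyI[of 1])
        fix n :: nat
        assume "1 \<le> n"
        then have "exp (- 2 * K * (t / real n)) \<noteq> 1"
          using False assms by simp
        then show "(1 - exp (- 2 * K * t)) / (2 * K) /
          ((exp (- 2 * K * (t / real n)) - 1) / (- 2 * K * (t / real n))) = g n"
          using False assms \<open>1 \<le> n\<close> unfolding g_def by (simp add: field_simps)
      qed
    qed
  qed
  ultimately show ?thesis
    using False by (auto simp: M_const_def intro: Lim_transform_eventually)
qed

lemma M_const_pos:
  assumes "0 < t"
  shows "0 < M_const t K"
proof -
  have "0 < (1 - exp (- 2 * K * t)) / (2 * K)" if "K \<noteq> 0"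
    using that assms by (cases "0 < K") (auto simp: zero_less_divide_iff mult_less_0_iff zero_less_mult_iff)
  then show ?thesis
    using assms by (simp add: M_const_def)
qed

lemma exp_le_C_const:
  assumes "0 \<le> r" and "r \<le> t"
  shows "exp (- K * r) \<le> C_const t K"
proof -
  have "bdd_above ((\<lambda>s. exp (- K * (t - s))) ` {0..t})"
    by (intro compact_imp_bounded bounded_imp_bdd_above compact_continuous_image continuous_intros) auto
  from cSUP_upper[OF _ this, of "t - r"] show ?thesis
    using assms by (simp add: C_const_def)
qed

section \<open>Lipschitz functions\<close>

lemma Lip_bound:
  assumes "Metric_space UNIV d" and "f \<in> Lip d"
  shows "\<bar>f x - f y\<bar> \<le> lip_norm d f * d x y"
proof (cases "x = y")
  case True
  then show ?thesis
    using Metric_space.mdist_zero[OF assms(1)] by simp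
next
  case False
  interpret Metric_space UNIV d by fact
  have "0 < d x y"
    using False by simp
  moreover have "\<bar>f x - f y\<bar> / d x y \<le> lip_norm d f"
    unfolding lip_norm_def
    by (rule cSup_upper) (use assms False in \<open>auto simp: Lip_def lip_quotients_def\<close>)
  ultimately show ?thesis
    by (simp add: divide_le_eq)
qed

lemma LipI:
  assumes "Metric_space UNIV d" and "\<And>x y. \<bar>f x - f y\<bar> \<le> L * d x y"
  shows "f \<in> Lip d"
proof -
  interpret Metric_space UNIV d by fact
  show ?thesis
    unfolding Lip_def mem_Collect_eq
    by (rule bdd_aboveI[of _ L]) (auto simp: lip_quotients_def divide_le_eq assms(2))
qed

text \<open>With a single state the set of quotients would be empty and its real supremum
  uninformative; two distinct states exclude this.\<close>

lemma lip_norm_le: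
  assumes "Metric_space UNIV d" and "\<And>x y. \<bar>f x - f y\<bar> \<le> L * d x y" and "\<exists>x y :: 'a. x \<noteq> y"
  shows "lip_norm (d :: 'a \<Rightarrow> 'a \<Rightarrow> real) f \<le> L"
proof -
  interpret Metric_space UNIV d by fact
  show ?thesis
    unfolding lip_norm_def
    by (rule cSup_least) (use assms(3) in \<open>auto simp: lip_quotients_def divide_le_eq assms(2)\<close>)
qed

lemma lip_norm_nonneg:
  assumes "Metric_space UNIV d" and "f \<in> Lip d" and "\<exists>x y :: 'a. x \<noteq> y"
  shows "0 \<le> lip_norm (d :: 'a \<Rightarrow> 'a \<Rightarrow> real) f"
proof -
  interpret Metric_space UNIV d by fact
  obtain x y :: 'a where "x \<noteq> y"
    using assms(3) by blast
  then have "0 < d x y"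
    by simp
  moreover have "0 \<le> lip_norm d f * d x y"
    using Lip_bound[OF assms(1,2), of x y] by linarith
  ultimately show ?thesis
    using mult_neg_pos[of "lip_norm d f" "d x y"] by linarith
qed

section \<open>Step paths\<close>

text \<open>Around each time the path takes at most two values, its left limit and its current
  value, and finitely many such neighbourhoods cover the compact interval
  \<open>{0..t}\<close>.\<close>

lemma step_path_finite_range:
  assumes "step_path w"
  shows "finite (w ` {0..t})"
proof -
  have "\<exists>e>0. finite (w ` ({0..t} \<inter> {s - e<..<s + e}))" if s: "s \<in> {0..t}" for s
  proof -
    have "\<forall>\<^sub>F r in at_right s. w r = w s"
      using assms s by (auto simp: step_path_def)
    then obtain b where b: "s < b" "\<And>r. s < r \<Longrightarrow> r < b \<Longrightarrow> w r = w s"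
      by (auto simp: eventually_at_right[of s "s + 1"])
    obtain a v where a: "a < s" "\<And>r. a < r \<Longrightarrow> r < s \<Longrightarrow> 0 \<le> r \<Longrightarrow> w r = v"
    proof (cases "s = 0")
      \<comment> \<open>There is no left limit at 0. The value of \<open>v\<close> is immaterial
        here, since no time \<open>r\<close> satisfies both \<open>0 <= r\<close> and
        \<open>r < 0\<close>.\<close>
      case True
      then show ?thesis
        using that[of "-1" "w 0"] by auto
    next
      case False
      then have "0 < s"
        using s by auto
      then obtain v where "\<forall>\<^sub>F r in at_left s. w r = v"
        using assms unfolding step_path_def by blast
      then show ?thesis
        using that by (auto simp: eventually_at_left[of "s - 1" s])
    qed
    define e where "e = min (s - a) (b - s)"
    have "w ` ({0..t} \<inter> {s - e<..<s + e}) \<subseteq> {w s, v}"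
    proof
      fix z
      assume "z \<in> w ` ({0..t} \<inter> {s - e<..<s + e})"
      then obtain r where r: "z = w r" "0 \<le> r" "a < r" "r < b"
        by (auto simp: e_def)
      then show "z \<in> {w s, v}"
        using a(2)[of r] b(2)[of r] by (cases r s rule: linorder_cases) auto
    qed
    moreover have "0 < e"
      using a b by (simp add: e_def)
    ultimately show ?thesis
      by (meson finite.emptyI finite.insertI finite_subset)
  qed
  then obtain e where e: "\<And>s. s \<in> {0..t} \<Longrightarrow> 0 < e s \<and> finite (w ` ({0..t} \<inter> {s - e s<..<s + e s}))"
    by metis
  obtain C where C: "C \<subseteq> {0..t}" "finite C" "{0..t} \<subseteq> (\<Union>s\<in>C. {s - e s<..<s + e s})"
  proof (rule compactE_image[of "{0..t}" "{0..t}" "\<lambda>s. {s - e s<..<s + e s}"])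
    show "{0..t} \<subseteq> (\<Union>s\<in>{0..t}. {s - e s<..<s + e s})"
      using e by force
  qed auto
  have "w ` {0..t} \<subseteq> (\<Union>s\<in>C. w ` ({0..t} \<inter> {s - e s<..<s + e s}))"
    using C(3) by blast
  moreover have "finite (\<Union>s\<in>C. w ` ({0..t} \<inter> {s - e s<..<s + e s}))"
    using C e by blast
  ultimately show ?thesis
    by (rule finite_subset)
qed

text \<open>Observations of \<open>x\<close> and then \<open>y\<close> at ever closer times reveal a
  genuine jump. At an accumulation point \<open>r\<close> of these times the path is constant just
  before \<open>r\<close> and constant from \<open>r\<close> on, so the observed change must
  straddle \<open>r\<close>.\<close>

lemma step_path_jump_limit:
  assumes w: "step_path w"
    and a: "\<And>i. 0 \<le> a i" "\<And>i. a i < c i" "\<And>i. c i \<le> (T::real)"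
    and wa: "\<And>i. w (a i) = x" and wc: "\<And>i. w (c i) = y"
    and lim: "(\<lambda>i. c i - a i) \<longlonglongrightarrow> 0" and "x \<noteq> y"
  shows "\<exists>r>0. left_limit w r = x \<and> w r = y"
proof -
  have "a i \<in> {0..T}" for i
    using a[of i] by auto
  then obtain r \<phi> where r: "r \<in> {0..T}" "strict_mono \<phi>" "(a \<circ> \<phi>) \<longlonglongrightarrow> r"
    using compact_Icc[of 0 T] unfolding compact_def by meson
  have "(\<lambda>i. (a \<circ> \<phi>) i + (c (\<phi> i) - a (\<phi> i))) \<longlonglongrightarrow> r + 0"
    using r(3) LIMSEQ_subseq_LIMSEQ[OF lim r(2)] by (intro tendsto_add) (auto simp: o_def)
  then have rc: "(\<lambda>i. c (\<phi> i)) \<longlonglongrightarrow> r"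
    by simp
  have "\<forall>\<^sub>F s in at_right r. w s = w r"
    using w r by (auto simp: step_path_def)
  then obtain b where b: "r < b" "\<And>s. r < s \<Longrightarrow> s < b \<Longrightarrow> w s = w r"
    by (auto simp: eventually_at_right[of r "r + 1"])
  have b': "w s = w r" if "r \<le> s" "s < b" for s
    using that b(2)[of s] by (cases "s = r") auto
  have cb: "\<forall>\<^sub>F i in sequentially. c (\<phi> i) < b"
    using order_tendstoD(2)[OF rc b(1)] .
  have "r \<noteq> 0"
  proof
    assume "r = 0"
    from eventually_happens[OF cb] obtain i where "c (\<phi> i) < b"
      by auto
    then have "x = y"
      using b'[of "c (\<phi> i)"] b'[of "a (\<phi> i)"] a(1,2)[of "\<phi> i"] wa[of "\<phi> i"] wc[of "\<phi> i"] \<open>r = 0\<close>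
      by simp
    with \<open>x \<noteq> y\<close> show False ..
  qed
  then have "0 < r"
    using r by auto
  then obtain v where v: "\<forall>\<^sub>F s in at_left r. w s = v"
    using w by (auto simp: step_path_def)
  then obtain e where e: "e < r" "\<And>s. e < s \<Longrightarrow> s < r \<Longrightarrow> w s = v"
    by (auto simp: eventually_at_left[of "r - 1" r])
  have "\<forall>\<^sub>F i in sequentially. e < a (\<phi> i)"
    using order_tendstoD(1)[OF r(3) e(1)] by simp
  with cb have "\<forall>\<^sub>F i in sequentially. e < a (\<phi> i) \<and> c (\<phi> i) < b"
    by eventually_elim auto
  from eventually_happens[OF this] obtain i where i: "e < a (\<phi> i)" "c (\<phi> i) < b"
    by auto
  \<comment> \<open>Otherwise both observations would lie in \<open>[r, b)\<close>, where the path
    is constant. Symmetrically, \<open>c (\<phi> i)\<close> cannot lie before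
    \<open>r\<close>.\<close>
  have "a (\<phi> i) < r"
    using b'[of "c (\<phi> i)"] b'[of "a (\<phi> i)"] a(2)[of "\<phi> i"] i wa[of "\<phi> i"] wc[of "\<phi> i"] \<open>x \<noteq> y\<close>
    by (cases "a (\<phi> i) < r") auto
  then have "v = x"
    using e(2)[of "a (\<phi> i)"] i wa by simp
  have "r \<le> c (\<phi> i)"
    using e(2)[of "c (\<phi> i)"] i a(2)[of "\<phi> i"] wc[of "\<phi> i"] \<open>v = x\<close> \<open>x \<noteq> y\<close> by force
  then have "w r = y"
    using b'[of "c (\<phi> i)"] i wc by simp
  moreover have "left_limit w r = x"
    unfolding left_limit_def
  proof (rule the_equality)
    show "\<forall>\<^sub>F s in at_left r. w s = x"
      using v \<open>v = x\<close> by simp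
    fix z
    assume "\<forall>\<^sub>F s in at_left r. w s = z"
    with v have "\<forall>\<^sub>F s in at_left r. z = v"
      by eventually_elim simp
    then show "z = x"
      using \<open>v = x\<close> by (simp add: eventually_const_iff)
  qed
  ultimately show ?thesis
    using \<open>0 < r\<close> by blast
qed

section \<open>The law of the chain\<close>

context regular_nonexplosive_chain
begin

text \<open>Countability of the state space makes the law discrete. For negative times nothing is
  known about \<open>X t\<close> and the value is arbitrary.\<close>

definition law :: "real \<Rightarrow> 'a \<Rightarrow> 'a pmf" where
  "law t x = Abs_pmf (trans_law M X t x)"

text \<open>The diagonal of \<open>Q\<close> is unconstrained, so it is cleared before rates are
  summed over all states.\<close>

definition rate :: "'a \<Rightarrow> 'a \<Rightarrow> real" where
  "rate x y = (if y = x then 0 else Q x y)"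

section \<open>Transition probabilities and the semigroup property\<close>

lemma measure_pmf_law:
  assumes "0 \<le> t"
  shows "measure_pmf (law t x) = distr (M x) (count_space UNIV) (X t)"
proof -
  interpret prob_space "M x" by (rule prob_space_M)
  let ?N = "distr (M x) (count_space UNIV) (X t)"
  interpret N: prob_space ?N
    by (rule prob_space_distr) (rule measurable_X[OF assms])
  have "AE y in ?N. measure ?N {y} \<noteq> 0"
    by (subst N.AE_support_countable) (auto intro!: exI[of _ UNIV])
  then show ?thesis
    unfolding law_def trans_law_def
    by (subst Abs_pmf_inverse) (auto simp: N.prob_space_axioms)
qed

lemma X_event [measurable]:
  assumes "0 \<le> t"
  shows "{\<omega> \<in> space (M x). X t \<omega> \<in> A} \<in> sets (M x)"
  using measurable_sets[OF measurable_X[OF assms, of x], of A]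
  by (simp add: vimage_def Int_def conj_commute)

lemma X_event_eq:
  assumes "0 \<le> t"
  shows "{\<omega> \<in> space (M x). X t \<omega> = y} \<in> sets (M x)"
  using X_event[OF assms, of x "{y}"] by simp

lemma pmf_law:
  assumes "0 \<le> t"
  shows "pmf (law t x) y = measure (M x) {\<omega> \<in> space (M x). X t \<omega> = y}"
proof -
  have "pmf (law t x) y = measure (distr (M x) (count_space UNIV) (X t)) {y}"
    by (simp add: pmf.rep_eq measure_pmf_law[OF assms])
  also have "\<dots> = measure (M x) (X t -` {y} \<inter> space (M x))"
    by (rule measure_distr) (use measurable_X[OF assms] in auto)
  also have "X t -` {y} \<inter> space (M x) = {\<omega> \<in> space (M x). X t \<omega> = y}"
    by auto
  finally show ?thesis .
qed

lemma expectation_law: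
  fixes g :: "'a \<Rightarrow> real"
  assumes "0 \<le> t"
  shows "measure_pmf.expectation (law t x) g = semigroup_op M X t g x"
  unfolding measure_pmf_law[OF assms] semigroup_op_def
  by (rule integral_distr) (use measurable_X[OF assms] in auto)

lemma law_0: "law 0 x = return_pmf x"
proof -
  have "AE y in measure_pmf (law 0 x). y = x"
    unfolding measure_pmf_law[OF order_refl]
    by (subst AE_distr_iff) (use measurable_X[of 0 x] initial[of x] in auto)
  then have "set_pmf (law 0 x) \<subseteq> {x}"
    by (auto simp: AE_measure_pmf_iff)
  then show ?thesis
    by (simp add: set_pmf_subset_singleton)
qed

text \<open>This is the Chapman-Kolmogorov equation: the Markov property with an empty past, summed
  over the countably many intermediate states.\<close>

lemma law_add:
  assumes "0 \<le> s" "0 \<le> t"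
  shows "law (s + t) x = bind_pmf (law s x) (law t)"
proof (rule pmf_eqI)
  fix z
  interpret prob_space "M x" by (rule prob_space_M)
  let ?A = "\<lambda>y. {\<omega> \<in> space (M x). X (s + t) \<omega> = z \<and> X s \<omega> = y}"
  have A: "?A y \<in> events" for y
    using assms X_event_eq[of "s + t" x z] X_event_eq[of s x y] by (intro sets.sets_Collect_conj) auto
  have "ennreal (pmf (bind_pmf (law s x) (law t)) z)
      = (\<integral>\<^sup>+y. ennreal (pmf (law s x) y) * ennreal (pmf (law t y) z) \<partial>count_space UNIV)"
    by (simp add: ennreal_pmf_bind nn_integral_measure_pmf)
  also have "\<dots> = (\<integral>\<^sup>+y. emeasure (M x) (?A y) \<partial>count_space UNIV)"
  proof (intro nn_integral_cong)
    fix y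
    have "prob (?A y) = pmf (law s x) y * pmf (law t y) z"
      using markov[of s t "{}" x z y] assms by (simp add: pmf_law)
    then show "ennreal (pmf (law s x) y) * ennreal (pmf (law t y) z) = emeasure (M x) (?A y)"
      by (simp add: emeasure_eq_measure ennreal_mult)
  qed
  also have "\<dots> = emeasure (M x) (\<Union>y. ?A y)"
    using A by (intro emeasure_UN_countable[symmetric]) (auto simp: disjoint_family_on_def)
  also have "(\<Union>y. ?A y) = {\<omega> \<in> space (M x). X (s + t) \<omega> = z}"
    by auto
  also have "emeasure (M x) \<dots> = ennreal (pmf (law (s + t) x) z)"
    using assms by (simp add: pmf_law emeasure_eq_measure)
  finally show "pmf (law (s + t) x) z = pmf (bind_pmf (law s x) (law t)) z"
    by simp
qed

lemma semigroup_op_add: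
  assumes "0 \<le> s" "0 \<le> t" and "\<And>y. \<bar>f y\<bar> \<le> B"
  shows "semigroup_op M X (s + t) f x = semigroup_op M X s (semigroup_op M X t f) x"
proof -
  have "semigroup_op M X (s + t) f x = measure_pmf.expectation (bind_pmf (law s x) (law t)) f"
    using assms by (simp add: expectation_law[symmetric] law_add)
  also have "\<dots> = measure_pmf.expectation (law s x) (\<lambda>y. measure_pmf.expectation (law t y) f)"
    unfolding measure_pmf_bind
    by (rule integral_bind[where K = "count_space UNIV" and B' = 1 and B = B])
      (use assms in \<open>auto simp: measure_pmf.emeasure_space_1 space_subprob_algebra intro!: prob_space_imp_subprob_space measure_pmf.prob_space_axioms\<close>)
  also have "\<dots> = semigroup_op M X s (semigroup_op M X t f) x"
    using assms by (simp add: expectation_law)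
  finally show ?thesis .
qed

lemma semigroup_op_0: "semigroup_op M X 0 f x = f x"
  by (simp add: expectation_law[symmetric] law_0)

lemma semigroup_op_bounded:
  assumes "0 \<le> t" and "\<And>y. \<bar>f y\<bar> \<le> B"
  shows "\<bar>semigroup_op M X t f x\<bar> \<le> B"
proof -
  have "0 \<le> B"
    using assms(2)[of x] by linarith
  have "\<bar>measure_pmf.expectation (law t x) f\<bar> \<le> measure_pmf.expectation (law t x) (\<lambda>y. \<bar>f y\<bar>)"
    by simp
  also have "\<dots> \<le> B"
    using assms(2) \<open>0 \<le> B\<close>
    by (intro measure_pmf.integral_le_const measure_pmf.integrable_const_bound[where B = B]) auto
  finally show ?thesis
    using assms(1) by (simp add: expectation_law)
qed

section \<open>The Markov property along a skeleton killed outside a finite set\<close>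

lemma skeleton_event:
  assumes "finite J" and "J \<subseteq> {0..}" and "{\<omega> \<in> space (M x). P \<omega>} \<in> sets (M x)"
  shows "{\<omega> \<in> space (M x). P \<omega> \<and> (\<forall>r\<in>J. X r \<omega> \<in> A r)} \<in> sets (M x)"
  by (intro sets.sets_Collect_conj sets.sets_Collect_finite_All assms X_event) (use assms in auto)

text \<open>The assumption \<open>markov\<close> speaks of exactly prescribed pasts. Since
  \<open>J\<close> and \<open>S\<close> are finite, staying in \<open>S\<close> at the times in
  \<open>J\<close> is a finite disjoint union of such pasts.\<close>

lemma measure_split_finite:
  assumes "finite J" and "J \<subseteq> {0..}" and "finite S" and P: "{\<omega> \<in> space (M x). P \<omega>} \<in> sets (M x)"
  shows "measure (M x) {\<omega> \<in> space (M x). P \<omega> \<and> (\<forall>r\<in>J. X r \<omega> \<in> S)}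
    = (\<Sum>u\<in>J \<rightarrow>\<^sub>E S. measure (M x) {\<omega> \<in> space (M x). P \<omega> \<and> (\<forall>r\<in>J. X r \<omega> = u r)})"
proof -
  interpret prob_space "M x" by (rule prob_space_M)
  let ?A = "\<lambda>u. {\<omega> \<in> space (M x). P \<omega> \<and> (\<forall>r\<in>J. X r \<omega> = u r)}"
  have "{\<omega> \<in> space (M x). P \<omega> \<and> (\<forall>r\<in>J. X r \<omega> \<in> S)} = (\<Union>u\<in>J \<rightarrow>\<^sub>E S. ?A u)"
  proof (intro equalityI subsetI)
    fix \<omega>
    assume "\<omega> \<in> {\<omega> \<in> space (M x). P \<omega> \<and> (\<forall>r\<in>J. X r \<omega> \<in> S)}"
    then show "\<omega> \<in> (\<Union>u\<in>J \<rightarrow>\<^sub>E S. ?A u)"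
      by (intro UN_I[of "restrict (\<lambda>r. X r \<omega>) J"]) auto
  qed auto
  moreover have "?A u \<in> events" for u
    using skeleton_event[OF assms(1,2) P, of "\<lambda>r. {u r}"] by simp
  moreover have "disjoint_family_on ?A (J \<rightarrow>\<^sub>E S)"
    unfolding disjoint_family_on_def
  proof (intro ballI impI)
    fix u v
    assume "u \<in> J \<rightarrow>\<^sub>E S" "v \<in> J \<rightarrow>\<^sub>E S" "u \<noteq> v"
    then obtain r where "r \<in> J" "u r \<noteq> v r"
      by (meson PiE_ext)
    then show "?A u \<inter> ?A v = {}"
      by force
  qed
  ultimately show ?thesis
    using assms by (simp add: finite_measure_finite_Union[OF finite_PiE] image_subset_iff)
qed

lemma markov_finite_set:
  assumes "0 \<le> s" "0 \<le> t" "finite J" "J \<subseteq> {0..s}" "finite S"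
  shows "measure (M x) {\<omega> \<in> space (M x). X (s + t) \<omega> = z \<and> X s \<omega> = y \<and> (\<forall>r\<in>J. X r \<omega> \<in> S)}
    = measure (M x) {\<omega> \<in> space (M x). X s \<omega> = y \<and> (\<forall>r\<in>J. X r \<omega> \<in> S)} * pmf (law t y) z"
proof -
  have J: "J \<subseteq> {0..}"
    using assms by auto
  have 1: "{\<omega> \<in> space (M x). X s \<omega> = y} \<in> sets (M x)"
    by (rule X_event_eq) fact
  have 2: "{\<omega> \<in> space (M x). X (s + t) \<omega> = z \<and> X s \<omega> = y} \<in> sets (M x)"
    using assms by (intro sets.sets_Collect_conj X_event_eq) auto
  show ?thesis
    using measure_split_finite[OF assms(3) J assms(5) 1] measure_split_finite[OF assms(3) J assms(5) 2]
      markov[OF assms(1-4)] assms(2)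
    by (simp add: sum_distrib_right pmf_law conj_assoc)
qed

text \<open>The skeleton is killed on leaving \<open>S\<close>, but its current position is not yet tested.\<close>

definition skeleton_mass :: "'a set \<Rightarrow> real \<Rightarrow> 'a \<Rightarrow> nat \<Rightarrow> 'a \<Rightarrow> real" where
  "skeleton_mass S h x k y =
     measure (M x) {\<omega> \<in> space (M x). X (real k * h) \<omega> = y \<and> (\<forall>j<k. X (real j * h) \<omega> \<in> S)}"

lemma skeleton_mass_0: "skeleton_mass S h x 0 y = of_bool (y = x)"
  using pmf_law[of 0 x y] by (auto simp: skeleton_mass_def law_0)

lemma skeleton_mass_nonneg: "0 \<le> skeleton_mass S h x k y"
  by (simp add: skeleton_mass_def)

lemma skeleton_step:
  assumes "0 \<le> h" "finite S"
  shows "measure (M x) {\<omega> \<in> space (M x). X (real (Suc k) * h) \<omega> = z \<and> X (real k * h) \<omega> = y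
      \<and> (\<forall>j<k. X (real j * h) \<omega> \<in> S)} = skeleton_mass S h x k y * pmf (law h y) z"
proof -
  have "(\<lambda>j. real j * h) ` {..<k} \<subseteq> {0..real k * h}"
    using assms by (auto intro!: mult_right_mono)
  from markov_finite_set[OF _ assms(1) _ this assms(2), of x z y] assms(1)
  show ?thesis
    by (simp add: skeleton_mass_def lessThan_def algebra_simps)
qed

lemma skeleton_events:
  assumes "0 \<le> h"
  shows "{\<omega> \<in> space (M x). X (real k * h) \<omega> = y \<and> (\<forall>j<k. X (real j * h) \<omega> \<in> S)} \<in> sets (M x)"
proof -
  have "(\<lambda>j. real j * h) ` {..<k} \<subseteq> {0..}"
    using assms by auto
  from skeleton_event[OF _ this X_event_eq[of "real k * h" x y], of "\<lambda>_. S"] assms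
  show ?thesis
    by (simp add: lessThan_def)
qed

text \<open>The sum runs over \<open>S\<close> only, because step \<open>k + 1\<close> tests the
  position at step \<open>k\<close> and discards the mass outside \<open>S\<close>. The new position
  \<open>z\<close> is arbitrary.\<close>

lemma skeleton_mass_Suc:
  assumes "0 \<le> h" "finite S"
  shows "skeleton_mass S h x (Suc k) z = (\<Sum>y\<in>S. skeleton_mass S h x k y * pmf (law h y) z)"
proof -
  interpret prob_space "M x" by (rule prob_space_M)
  let ?A = "\<lambda>y. {\<omega> \<in> space (M x). X (real (Suc k) * h) \<omega> = z \<and> X (real k * h) \<omega> = y
      \<and> (\<forall>j<k. X (real j * h) \<omega> \<in> S)}"
  have "{\<omega> \<in> space (M x). X (real (Suc k) * h) \<omega> = z \<and> (\<forall>j<Suc k. X (real j * h) \<omega> \<in> S)}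
      = (\<Union>y\<in>S. ?A y)"
    by (auto simp: less_Suc_eq)
  then have "skeleton_mass S h x (Suc k) z = prob (\<Union>y\<in>S. ?A y)"
    by (simp only: skeleton_mass_def)
  also have "\<dots> = (\<Sum>y\<in>S. prob (?A y))"
  proof (rule finite_measure_finite_Union)
    have "?A y \<in> events" for y
      by (intro sets.sets_Collect_conj[OF skeleton_events X_event_eq]) (use assms in auto)
    then show "?A ` S \<subseteq> events"
      by blast
    show "disjoint_family_on ?A S"
      by (auto simp: disjoint_family_on_def)
  qed (rule assms)
  also have "\<dots> = (\<Sum>y\<in>S. skeleton_mass S h x k y * pmf (law h y) z)"
    by (simp only: skeleton_step[OF assms])
  finally show ?thesis .
qed

end

section \<open>Rates and jumps\<close>

context regular_nonexplosive_chain
begin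

section \<open>Short-time asymptotics of the transition probabilities\<close>

lemma Q_nonneg: "x \<noteq> y \<Longrightarrow> 0 \<le> Q x y"
  using regular by (simp add: regular_rates_def)

lemma rate_nonneg: "0 \<le> rate x y"
  by (simp add: rate_def Q_nonneg)

lemma nn_integral_rate: "(\<integral>\<^sup>+y. ennreal (rate x y) \<partial>count_space UNIV) = ennreal (exit_rate Q x)"
proof -
  have "Q x summable_on (UNIV - {x})"
    using regular by (simp add: regular_rates_def)
  then have "(\<lambda>y. norm (Q x y)) summable_on (UNIV - {x})"
    by (rule summable_on_cong[THEN iffD1, rotated]) (simp add: Q_nonneg)
  then have abs: "Infinite_Set_Sum.abs_summable_on (Q x) (UNIV - {x})"
    by (simp add: abs_summable_equivalent[symmetric])
  have "(\<integral>\<^sup>+y. ennreal (rate x y) \<partial>count_space UNIV)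
      = (\<integral>\<^sup>+y. ennreal (Q x y) * indicator (UNIV - {x}) y \<partial>count_space UNIV)"
    by (intro nn_integral_cong) (auto simp: rate_def)
  also have "\<dots> = (\<integral>\<^sup>+y. ennreal (Q x y) \<partial>count_space (UNIV - {x}))"
    by (simp add: nn_integral_count_space_indicator)
  also have "\<dots> = ennreal (infsetsum (Q x) (UNIV - {x}))"
    by (rule nn_integral_conv_infsetsum[OF abs]) (simp add: Q_nonneg)
  also have "\<dots> = ennreal (exit_rate Q x)"
    by (simp add: infsetsum_infsum[OF abs] exit_rate_def)
  finally show ?thesis .
qed

lemma exit_rate_nonneg: "0 \<le> exit_rate Q x"
  unfolding exit_rate_def by (intro infsum_nonneg) (auto simp: Q_nonneg)

lemma generator_indicator:
  assumes "x \<noteq> y"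
  shows "generator Q (indicator {y}) x = Q x y"
proof -
  have "generator Q (indicator {y}) x = (\<Sum>\<^sub>\<infinity>z\<in>{y}. Q x z)"
    unfolding generator_def by (rule infsum_cong_neutral) (use assms in auto)
  then show ?thesis
    by simp
qed

lemma generator_indicator_Compl: "generator Q (indicator (- {x})) x = exit_rate Q x"
  unfolding generator_def exit_rate_def by (rule infsum_cong_neutral) auto

text \<open>Indicators are bounded, so the generator assumption applies to them. The set
  \<open>{y}\<close> yields a single rate, and the complement of \<open>{x}\<close> yields the total
  exit rate.\<close>

lemma indicator_rate_tendsto:
  assumes "\<And>n. 0 < h n" and "h \<longlonglongrightarrow> 0" and "x \<notin> A"
  shows "(\<lambda>n. measure_pmf.prob (law (h n) x) A / h n) \<longlonglongrightarrow> generator Q (indicator A) x"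
proof -
  have "bounded (range (indicator A :: 'a \<Rightarrow> real))"
    by (rule boundedI[of _ 1]) (auto simp: indicator_def)
  moreover have "filterlim h (at_right 0) sequentially"
    by (intro tendsto_imp_filterlim_at_right) (use assms in auto)
  ultimately have "(\<lambda>n. (semigroup_op M X (h n) (indicator A) x - indicator A x) / h n)
      \<longlonglongrightarrow> generator Q (indicator A) x"
    by (rule filterlim_compose[OF has_generator])
  moreover have "semigroup_op M X (h n) (indicator A) x = measure_pmf.prob (law (h n) x) A" for n
    using assms(1)[of n] by (simp add: expectation_law[symmetric] less_imp_le)
  ultimately show ?thesis
    using assms(3) by simp
qed

lemma rate_tendsto:
  assumes "\<And>n. 0 < h n" and "h \<longlonglongrightarrow> 0" and "x \<noteq> y"
  shows "(\<lambda>n. pmf (law (h n) x) y / h n) \<longlonglongrightarrow> Q x y"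
  using indicator_rate_tendsto[of h x "{y}"] assms
  by (simp add: generator_indicator measure_pmf_single)

lemma exit_rate_tendsto:
  assumes "\<And>n. 0 < h n" and "h \<longlonglongrightarrow> 0"
  shows "(\<lambda>n. (1 - pmf (law (h n) x) x) / h n) \<longlonglongrightarrow> exit_rate Q x"
proof -
  have "measure_pmf.prob (law (h n) x) (- {x}) = 1 - pmf (law (h n) x) x" for n
    using measure_pmf.prob_compl[of "{x}" "law (h n) x"]
    by (simp add: measure_pmf_single Compl_eq_Diff_UNIV)
  then show ?thesis
    using indicator_rate_tendsto[of h x "- {x}"] assms by (simp add: generator_indicator_Compl)
qed

text \<open>This is the l1 distance between the off-diagonal part of the law at time
  \<open>h\<close>, divided by \<open>h\<close>, and the rates out of \<open>x\<close>. Values in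
  \<open>ennreal\<close> spare any summability condition.\<close>

definition rate_error :: "real \<Rightarrow> 'a \<Rightarrow> ennreal" where
  "rate_error h x =
     (\<integral>\<^sup>+y. ennreal \<bar>of_bool (y \<noteq> x) * pmf (law h x) y / h - rate x y\<bar> \<partial>count_space UNIV)"

lemma nn_integral_off_diagonal:
  assumes "0 < h"
  shows "(\<integral>\<^sup>+y. ennreal (of_bool (y \<noteq> x) * pmf (law h x) y / h) \<partial>count_space UNIV)
    = ennreal ((1 - pmf (law h x) x) / h)"
proof -
  have "(\<integral>\<^sup>+y. ennreal (of_bool (y \<noteq> x) * pmf (law h x) y / h) \<partial>count_space UNIV)
      = (\<integral>\<^sup>+y. ennreal (pmf (law h x) y) * (indicator (- {x}) y * ennreal (1 / h)) \<partial>count_space UNIV)"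
    using assms by (intro nn_integral_cong) (auto simp: ennreal_mult[symmetric])
  also have "\<dots> = (\<integral>\<^sup>+y. indicator (- {x}) y * ennreal (1 / h) \<partial>measure_pmf (law h x))"
    by (simp add: nn_integral_measure_pmf)
  also have "\<dots> = emeasure (measure_pmf (law h x)) (- {x}) * ennreal (1 / h)"
    by (simp add: nn_integral_multc)
  also have "\<dots> = ennreal ((1 - pmf (law h x) x) / h)"
    using measure_pmf.prob_compl[of "{x}" "law h x"] assms
    by (simp add: measure_pmf_single Compl_eq_Diff_UNIV measure_pmf.emeasure_eq_measure
        ennreal_mult[symmetric] pmf_le_1)
  finally show ?thesis .
qed

text \<open>Pointwise convergence of the rates, together with convergence of the total exit rate,
  is convergence in \<open>\<ell>\<^sup>1\<close> by Scheffe's lemma. This makes the generator expansion uniform over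
  bounded functions.\<close>

lemma rate_error_tendsto:
  assumes "\<And>n. 0 < h n" and "h \<longlonglongrightarrow> 0"
  shows "(\<lambda>n. rate_error (h n) x) \<longlonglongrightarrow> 0"
proof -
  let ?F = "\<lambda>n y. of_bool (y \<noteq> x) * pmf (law (h n) x) y / h n"
  have F0: "0 \<le> ?F n y" for n y
    using assms(1)[of n] by simp
  have F: "(\<integral>\<^sup>+y. ennreal (norm (?F n y)) \<partial>count_space UNIV) = ennreal ((1 - pmf (law (h n) x) x) / h n)" for n
    using nn_integral_off_diagonal[OF assms(1)[of n], of x] by (simp only: real_norm_def abs_of_nonneg[OF F0])
  have r: "(\<integral>\<^sup>+y. ennreal (norm (rate x y)) \<partial>count_space UNIV) = ennreal (exit_rate Q x)"
    by (simp add: nn_integral_rate rate_nonneg)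
  have "(\<lambda>n. \<integral>\<^sup>+y. norm (?F n y - rate x y) \<partial>count_space UNIV) \<longlonglongrightarrow> 0"
  proof (rule Scheffe_lemma1)
    show "integrable (count_space UNIV) (?F n)" for n
      by (rule integrableI_bounded) (simp_all only: F, simp_all)
    show "integrable (count_space UNIV) (rate x)"
      by (rule integrableI_bounded) (simp_all only: r, simp_all)
    show "AE y in count_space UNIV. (\<lambda>n. ?F n y) \<longlonglongrightarrow> rate x y"
      using rate_tendsto[OF assms, of x] by (auto simp: AE_count_space rate_def)
    have "(\<lambda>n. ennreal ((1 - pmf (law (h n) x) x) / h n)) \<longlonglongrightarrow> ennreal (exit_rate Q x)"
      by (intro tendsto_ennrealI exit_rate_tendsto assms)
    then show "limsup (\<lambda>n. \<integral>\<^sup>+y. norm (?F n y) \<partial>count_space UNIV)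
        \<le> (\<integral>\<^sup>+y. norm (rate x y) \<partial>count_space UNIV)"
      unfolding F r by (simp add: lim_imp_Limsup)
  qed
  then show ?thesis
    by (simp add: rate_error_def)
qed

text \<open>Since \<open>G\<close> vanishes at \<open>x\<close>, only off-diagonal mass counts, and
  replacing it by \<open>h\<close> times the rates costs at most \<open>h * B\<close> times the l1
  error. The error depends on \<open>G\<close> only through its bound.\<close>

lemma nn_integral_law_le_rate:
  assumes "0 < h" and "\<And>y. 0 \<le> G y" and "\<And>y. G y \<le> B" and "G x = 0"
  shows "(\<integral>\<^sup>+y. ennreal (G y) \<partial>measure_pmf (law h x))
    \<le> ennreal h * ((\<integral>\<^sup>+y. ennreal (rate x y * G y) \<partial>count_space UNIV) + ennreal B * rate_error h x)"
proof -
  have "0 \<le> B"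
    using assms(2,3)[of x] by linarith
  have "(\<integral>\<^sup>+y. ennreal (G y) \<partial>measure_pmf (law h x))
      = (\<integral>\<^sup>+y. ennreal (pmf (law h x) y * G y) \<partial>count_space UNIV)"
    by (simp add: nn_integral_measure_pmf ennreal_mult assms)
  also have "\<dots> \<le> (\<integral>\<^sup>+y. ennreal h * (ennreal (rate x y * G y)
      + ennreal B * ennreal \<bar>of_bool (y \<noteq> x) * pmf (law h x) y / h - rate x y\<bar>) \<partial>count_space UNIV)"
  proof (intro nn_integral_mono)
    fix y
    have "pmf (law h x) y * G y \<le> h * (rate x y * G y + B * \<bar>of_bool (y \<noteq> x) * pmf (law h x) y / h - rate x y\<bar>)"
    proof (cases "y = x")
      case False
      let ?e = "pmf (law h x) y / h - rate x y"
      have "pmf (law h x) y * G y = h * (rate x y * G y + G y * ?e)"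
        using assms(1) by (simp add: field_simps)
      also have "\<dots> \<le> h * (rate x y * G y + B * \<bar>?e\<bar>)"
      proof -
        have "G y * ?e \<le> G y * \<bar>?e\<bar>"
          using assms(2) by (intro mult_left_mono) auto
        also have "\<dots> \<le> B * \<bar>?e\<bar>"
          using assms(3) by (intro mult_right_mono) auto
        finally show ?thesis
          using assms(1) by (intro mult_left_mono) auto
      qed
      finally show ?thesis
        using False by simp
    qed (use assms \<open>0 \<le> B\<close> in \<open>simp add: rate_def\<close>)
    then show "ennreal (pmf (law h x) y * G y) \<le> ennreal h * (ennreal (rate x y * G y)
      + ennreal B * ennreal \<bar>of_bool (y \<noteq> x) * pmf (law h x) y / h - rate x y\<bar>)"
      using assms \<open>0 \<le> B\<close> rate_nonneg[of x y]
      by (simp add: ennreal_mult[symmetric] ennreal_plus[symmetric] del: ennreal_plus)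
  qed
  also have "\<dots> = ennreal h * ((\<integral>\<^sup>+y. ennreal (rate x y * G y) \<partial>count_space UNIV) + ennreal B * rate_error h x)"
    by (simp add: nn_integral_cmult nn_integral_add rate_error_def)
  finally show ?thesis .
qed

section \<open>Positive rates are realized by jumps of the paths\<close>

lemma skeleton_mass_singleton:
  assumes "0 \<le> h"
  shows "skeleton_mass {x} h x k x = pmf (law h x) x ^ k"
  by (induction k) (simp_all add: skeleton_mass_0 skeleton_mass_Suc assms)

text \<open>If \<open>Q x y\<close> is positive, the skeleton of mesh \<open>h n\<close> shows
  \<open>x\<close> directly followed by \<open>y\<close> before time \<open>T\<close> with
  probability at least \<open>c > 0\<close> for all large \<open>n\<close>. Hence with probability
  at least \<open>c\<close> this happens for infinitely many meshes, and there
  \<open>step_path_jump_limit\<close> provides a true jump.\<close>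

lemma rate_pos_imp_jump:
  assumes "x \<noteq> y" and "0 < Q x y"
    and no_jump: "AE \<omega> in M x. \<forall>r>0. \<not> (left_limit (\<lambda>s. X s \<omega>) r = x \<and> X r \<omega> = y)"
  shows False
proof -
  interpret prob_space "M x" by (rule prob_space_M)
  define q where "q = exit_rate Q x"
  \<comment> \<open>With \<open>(q + 1) * T = 1 / 2\<close>, Bernoulli's inequality keeps the
    probability of staying at \<open>x\<close> along the whole skeleton above 1/2.\<close>
  define T where "T = 1 / (2 * (q + 1))"
  define h where "h n = T / real (Suc n)" for n
  have q: "0 \<le> q"
    by (simp add: q_def exit_rate_nonneg)
  have T: "0 < T" "(q + 1) * T = 1 / 2"
    using q by (simp_all add: T_def)
  have h: "0 < h n" for n
    using T by (simp add: h_def)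
  have hlim: "h \<longlonglongrightarrow> 0"
    using LIMSEQ_Suc[OF lim_const_over_n[of T]] by (simp add: h_def[abs_def])
  have sh: "real (Suc n) * h n = T" for n
    by (simp add: h_def)
  define A where "A n = {\<omega> \<in> space (M x). \<exists>k<Suc n. X (real (Suc k) * h n) \<omega> = y \<and> X (real k * h n) \<omega> = x}" for n
  \<comment> \<open>In \<open>D n k\<close> the first \<open>k\<close> steps stay at
    \<open>x\<close> and the next one goes to \<open>y\<close>. Requiring this whole past makes the
    events disjoint in \<open>k\<close>, so that their probabilities add up to a lower bound for
    that of \<open>A n\<close>.\<close>
  define D where "D n k = {\<omega> \<in> space (M x). X (real (Suc k) * h n) \<omega> = y \<and> X (real k * h n) \<omega> = x
      \<and> (\<forall>j<k. X (real j * h n) \<omega> \<in> {x})}" for n k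
  have A_event: "A n \<in> events" for n
  proof -
    have "A n = (\<Union>k<Suc n. {\<omega> \<in> space (M x). X (real (Suc k) * h n) \<omega> = y \<and> X (real k * h n) \<omega> = x})"
      by (auto simp: A_def)
    also have "\<dots> \<in> events"
      using h[of n] by (intro sets.finite_UN sets.sets_Collect_conj X_event_eq) auto
    finally show ?thesis .
  qed
  have D_event: "D n k \<in> events" for n k
    unfolding D_def
    by (intro sets.sets_Collect_conj[OF skeleton_events X_event_eq]) (use h[of n] in auto)
  have prob_D: "prob (D n k) = pmf (law (h n) x) x ^ k * pmf (law (h n) x) y" for n k
    using h[of n] unfolding D_def by (subst skeleton_step) (auto simp: skeleton_mass_singleton less_imp_le)
  have lower: "real (Suc n) * (pmf (law (h n) x) x ^ Suc n * pmf (law (h n) x) y) \<le> prob (A n)" for n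
  proof -
    have disj: "disjoint_family_on (D n) {..<Suc n}"
    proof -
      have "D n k \<inter> D n l = {}" if "k < l" for k l
      proof -
        have False if "\<omega> \<in> D n k" "\<omega> \<in> D n l" for \<omega>
        proof -
          have "X (real (Suc k) * h n) \<omega> = y" "X (real l * h n) \<omega> = x"
            "\<forall>j<l. X (real j * h n) \<omega> = x"
            using that by (auto simp: D_def)
          \<comment> \<open>At step \<open>k + 1\<close> the position is \<open>y\<close>, yet
            \<open>D n l\<close> forces \<open>x\<close> there, either as its position at step
            \<open>l\<close> or as an earlier one.\<close>
          moreover have "Suc k = l \<or> Suc k < l"
            using \<open>k < l\<close> by auto
          ultimately show False
            using assms(1) by auto
        qed
        then show ?thesis
          by blast
      qed
      then show ?thesis
        unfolding disjoint_family_on_def by (metis inf_commute linorder_neqE_nat)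
    qed
    have "real (Suc n) * (pmf (law (h n) x) x ^ Suc n * pmf (law (h n) x) y)
        = (\<Sum>k<Suc n. pmf (law (h n) x) x ^ Suc n * pmf (law (h n) x) y)"
      by simp
    also have "\<dots> \<le> (\<Sum>k<Suc n. prob (D n k))"
      unfolding prob_D
      by (intro sum_mono mult_right_mono power_decreasing) (auto simp: pmf_le_1 simp del: power_Suc)
    also have "\<dots> = prob (\<Union>k<Suc n. D n k)"
      using D_event disj by (intro finite_measure_finite_Union[symmetric]) auto
    also have "\<dots> \<le> prob (A n)"
    proof (rule finite_measure_mono[OF _ A_event])
      show "(\<Union>k<Suc n. D n k) \<subseteq> A n"
        unfolding A_def D_def by blast
    qed
    finally show ?thesis .
  qed
  \<comment> \<open>One factor 1/2 bounds the staying probability, the other replaces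
    \<open>pmf (law (h n) x) y / h n\<close> by half of its limit.\<close>
  define c where "c = T * Q x y / 4"
  have c: "0 < c"
    using T assms by (simp add: c_def)
  have ev_c: "\<forall>\<^sub>F n in sequentially. c \<le> prob (A n)"
  proof -
    have "\<forall>\<^sub>F n in sequentially. (1 - pmf (law (h n) x) x) / h n < q + 1"
      by (rule order_tendstoD(2)[OF exit_rate_tendsto[OF h hlim]]) (simp add: q_def)
    moreover have "\<forall>\<^sub>F n in sequentially. Q x y / 2 < pmf (law (h n) x) y / h n"
      by (rule order_tendstoD(1)[OF rate_tendsto[OF h hlim assms(1)]]) (use assms in simp)
    ultimately show ?thesis
    proof eventually_elim
      case (elim n)
      have stay: "1 - (q + 1) * h n \<le> pmf (law (h n) x) x"
        using elim(1) h[of n] by (simp add: field_simps)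
      have hT: "(q + 1) * h n \<le> 1 / 2"
      proof -
        have "h n \<le> T"
          using T(1) by (simp add: h_def field_simps)
        then show ?thesis
          using mult_left_mono[of "h n" T "q + 1"] q T(2) by simp
      qed
      have "1 / 2 = 1 + real (Suc n) * (- ((q + 1) * h n))"
      proof -
        have "real (Suc n) * ((q + 1) * h n) = 1 / 2"
          using sh[of n] T(2) by (metis mult.left_commute)
        then show ?thesis
          by simp
      qed
      also have "\<dots> \<le> (1 + - ((q + 1) * h n)) ^ Suc n"
        by (rule Bernoulli_inequality) (use hT in linarith)
      also have "\<dots> \<le> pmf (law (h n) x) x ^ Suc n"
        using stay hT by (intro power_mono) auto
      finally have half: "1 / 2 \<le> pmf (law (h n) x) x ^ Suc n" .
      have py: "Q x y / 2 * h n \<le> pmf (law (h n) x) y"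
        using elim(2) h[of n] by (simp add: field_simps)
      have "c = real (Suc n) * (1 / 2 * (Q x y / 2 * h n))"
        using sh[of n] by (simp add: c_def mult_ac)
      also have "\<dots> \<le> real (Suc n) * (pmf (law (h n) x) x ^ Suc n * pmf (law (h n) x) y)"
        using half py assms(2) h[of n] by (intro mult_left_mono mult_mono) auto
      also have "\<dots> \<le> prob (A n)"
        by (rule lower)
      finally show ?case .
    qed
  qed
  \<comment> \<open>The sets \<open>U N\<close> decrease to the event that \<open>A n\<close> occurs
    infinitely often.\<close>
  define U where "U N = (\<Union>n\<in>{N..}. A n)" for N
  have U_event: "U N \<in> events" for N
    unfolding U_def using A_event by (intro sets.countable_UN') auto
  have "decseq U"
    unfolding decseq_def U_def by (intro allI impI UN_mono) auto
  then have "(\<lambda>N. prob (U N)) \<longlonglongrightarrow> prob (\<Inter>N. U N)"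
    using U_event by (intro finite_Lim_measure_decseq) auto
  moreover have "c \<le> prob (U N)" for N
  proof -
    obtain n where "N \<le> n" "c \<le> prob (A n)"
      using ev_c unfolding eventually_sequentially by (meson linear order_refl)
    then show ?thesis
      using finite_measure_mono[OF _ U_event[of N], of "A n"] unfolding U_def by force
  qed
  ultimately have "c \<le> prob (\<Inter>N. U N)"
    by (meson LIMSEQ_le_const)
  moreover have "AE \<omega> in M x. \<omega> \<notin> (\<Inter>N. U N)"
    using nonexplosive no_jump
  proof eventually_elim
    case (elim \<omega>)
    show ?case
    proof
      assume "\<omega> \<in> (\<Inter>N. U N)"
      then have "\<exists>n\<ge>N. \<exists>k<Suc n. X (real (Suc k) * h n) \<omega> = y \<and> X (real k * h n) \<omega> = x" for N
        unfolding U_def A_def by blast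
      then obtain n k where nk: "\<And>N. N \<le> n N" "\<And>N. k N < Suc (n N)"
        "\<And>N. X (real (Suc (k N)) * h (n N)) \<omega> = y" "\<And>N. X (real (k N) * h (n N)) \<omega> = x"
        by metis
      have "\<exists>r>0. left_limit (\<lambda>s. X s \<omega>) r = x \<and> X r \<omega> = y"
      proof (rule step_path_jump_limit[where a = "\<lambda>N. real (k N) * h (n N)"
            and c = "\<lambda>N. real (Suc (k N)) * h (n N)" and T = T, OF elim(1)])
        show "real (Suc (k N)) * h (n N) \<le> T" for N
          unfolding sh[of "n N", symmetric]
          using nk(2)[of N] h[of "n N"] by (intro mult_right_mono) auto
        show "(\<lambda>N. real (Suc (k N)) * h (n N) - real (k N) * h (n N)) \<longlonglongrightarrow> 0"
        proof (rule tendsto_sandwich[OF _ _ tendsto_const hlim])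
          show "\<forall>\<^sub>F N in sequentially. 0 \<le> real (Suc (k N)) * h (n N) - real (k N) * h (n N)"
            using h by (simp add: algebra_simps less_imp_le)
          have "h (n N) \<le> h N" for N
            unfolding h_def using T nk(1)[of N] by (intro divide_left_mono) auto
          then show "\<forall>\<^sub>F N in sequentially. real (Suc (k N)) * h (n N) - real (k N) * h (n N) \<le> h N"
            by (simp add: algebra_simps)
        qed
      qed (use nk h assms(1) in \<open>auto simp: less_imp_le\<close>)
      with elim(2) show False
        by blast
    qed
  qed
  then have "prob (\<Inter>N. U N) = 0"
    using U_event by (subst (asm) AE_iff_null_sets[symmetric]) (auto simp: measure_eq_0_null_sets)
  ultimately show False
    using c by simp
qed

lemma rate_pos_imp_dist_le:
  assumes "jumps_bounded d M X b" and "0 < rate x y"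
  shows "d x y \<le> b"
proof (rule ccontr)
  assume "\<not> d x y \<le> b"
  have "AE \<omega> in M x. \<forall>r>0. d (left_limit (\<lambda>s. X s \<omega>) r) (X r \<omega>) \<le> b"
    using assms(1) by (simp add: jumps_bounded_def)
  then have "AE \<omega> in M x. \<forall>r>0. \<not> (left_limit (\<lambda>s. X s \<omega>) r = x \<and> X r \<omega> = y)"
    by eventually_elim (use \<open>\<not> d x y \<le> b\<close> in auto)
  then show False
    using assms(2) rate_pos_imp_jump[of x y] by (auto simp: rate_def split: if_splits)
qed

end

section \<open>Exponential moments\<close>

locale curved_chain = regular_nonexplosive_chain M X Q
  for M :: "'a::countable \<Rightarrow> 'w measure" and X :: "real \<Rightarrow> 'w \<Rightarrow> 'a" and Q :: "'a \<Rightarrow> 'a \<Rightarrow> real" +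
  fixes d :: "'a \<Rightarrow> 'a \<Rightarrow> real" and b V K :: real
  assumes metric: "Metric_space UNIV d"
    and two_states: "\<exists>x y :: 'a. x \<noteq> y"
    and b_pos: "0 < b" and jumps: "jumps_bounded d M X b"
    and angle_bracket: "angle_bracket_bounded d Q V"
    and curvature: "wasserstein_curvature_ge d M X K"
begin

lemma dist_nonneg: "0 \<le> d x y"
  using Metric_space.nonneg[OF metric] .

text \<open>Curvature controls positive times and the exact seminorm. Time 0 is the identity, and
  any Lipschitz constant \<open>L\<close> dominates the seminorm.\<close>

lemma lipschitz_semigroup_op:
  assumes "\<And>x y. \<bar>f x - f y\<bar> \<le> L * d x y" and "0 \<le> r"
  shows "\<bar>semigroup_op M X r f x - semigroup_op M X r f y\<bar> \<le> exp (- K * r) * L * d x y"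
proof (cases "r = 0")
  case True
  then show ?thesis
    using assms(1)[of x y] by (simp add: semigroup_op_0)
next
  case False
  have f: "f \<in> Lip d"
    by (rule LipI[OF metric assms(1)])
  have P: "semigroup_op M X r f \<in> Lip d"
    "lip_norm d (semigroup_op M X r f) \<le> exp (- K * r) * lip_norm d f"
    using curvature f False assms(2) by (auto simp: wasserstein_curvature_ge_def)
  have "lip_norm d f \<le> L"
    by (rule lip_norm_le[OF metric assms(1) two_states])
  then have "lip_norm d (semigroup_op M X r f) \<le> exp (- K * r) * L"
    by (intro order_trans[OF P(2)] mult_left_mono) auto
  then show ?thesis
    using Lip_bound[OF metric P(1), of x y] mult_right_mono[OF _ dist_nonneg[of x y]] order_trans by blast
qed

section \<open>Second-order expansion over one short step\<close>

lemma nn_integral_rate_dist_sq: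
  "(\<integral>\<^sup>+y. ennreal ((d x y)\<^sup>2 * Q x y) \<partial>count_space UNIV) \<le> ennreal (V\<^sup>2)"
  using angle_bracket unfolding angle_bracket_bounded_def by (meson SUP_le_iff UNIV_I)

text \<open>Where the rate is positive, \<open>d x y <= b\<close>, so the increment of
  \<open>u\<close> is at most \<open>l * b <= B\<close> and the remainder is at most a constant
  times \<open>(l * d x y)\<^sup>2\<close>. The angle bracket bounds the resulting sum.\<close>

lemma nn_integral_rate_exp_remainder:
  assumes u: "\<And>y z. \<bar>u y - u z\<bar> \<le> l * d y z" and "0 \<le> l" "l * b \<le> B" "0 < B"
  shows "(\<integral>\<^sup>+y. ennreal (rate x y * (exp (u y - u x) - 1 - (u y - u x))) \<partial>count_space UNIV)
    \<le> ennreal ((exp B - 1 - B) / B\<^sup>2 * l\<^sup>2 * V\<^sup>2)"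
proof -
  define k where "k = (exp B - 1 - B) / B\<^sup>2"
  have k: "0 \<le> k"
    unfolding k_def by (intro divide_nonneg_nonneg exp_remainder_nonneg) simp
  have "ennreal (rate x y * (exp (u y - u x) - 1 - (u y - u x)))
      \<le> ennreal (k * l\<^sup>2) * ennreal ((d x y)\<^sup>2 * Q x y)" for y
  proof (cases "0 < rate x y")
    case True
    then have "x \<noteq> y" "rate x y = Q x y"
      by (auto simp: rate_def split: if_splits)
    have abs: "\<bar>u y - u x\<bar> \<le> l * d x y"
      using u[of x y] by (simp add: abs_minus_commute)
    also have "\<dots> \<le> B"
      using mult_left_mono[OF rate_pos_imp_dist_le[OF jumps True] \<open>0 \<le> l\<close>] \<open>l * b \<le> B\<close> by linarith
    finally have "exp (u y - u x) - 1 - (u y - u x) \<le> (u y - u x)\<^sup>2 * k"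
      unfolding k_def by (rule exp_remainder_le) fact
    also have "\<dots> \<le> (l * d x y)\<^sup>2 * k"
      using power_mono[OF abs, of 2] k by (intro mult_right_mono) auto
    finally have "rate x y * (exp (u y - u x) - 1 - (u y - u x)) \<le> rate x y * ((l * d x y)\<^sup>2 * k)"
      by (rule mult_left_mono[OF _ rate_nonneg])
    also have "\<dots> = k * l\<^sup>2 * ((d x y)\<^sup>2 * Q x y)"
      using \<open>rate x y = Q x y\<close> by (simp add: power_mult_distrib mult_ac)
    finally show ?thesis
      using k Q_nonneg[OF \<open>x \<noteq> y\<close>] by (simp add: ennreal_mult[symmetric] ennreal_leI)
  next
    case False
    then have "rate x y = 0"
      using rate_nonneg[of x y] by linarith
    then show ?thesis
      by simp
  qed
  then have "(\<integral>\<^sup>+y. ennreal (rate x y * (exp (u y - u x) - 1 - (u y - u x))) \<partial>count_space UNIV)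
      \<le> (\<integral>\<^sup>+y. ennreal (k * l\<^sup>2) * ennreal ((d x y)\<^sup>2 * Q x y) \<partial>count_space UNIV)"
    by (intro nn_integral_mono)
  also have "\<dots> \<le> ennreal (k * l\<^sup>2) * ennreal (V\<^sup>2)"
    by (simp add: nn_integral_cmult mult_left_mono nn_integral_rate_dist_sq)
  also have "\<dots> = ennreal (k * l\<^sup>2 * V\<^sup>2)"
    using k by (simp add: ennreal_mult)
  finally show ?thesis
    unfolding k_def .
qed

text \<open>Write \<open>exp (u y)\<close> as \<open>exp (u x)\<close> times one plus the increment
  of \<open>u\<close> plus a remainder. The linear term integrates exactly to
  \<open>semigroup_op M X h u x - u x\<close>, the remainder is of order \<open>h\<close>, and
  \<open>1 + z <= exp z\<close> restores the exponential.\<close>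

lemma expectation_exp_one_step:
  assumes u: "\<And>y z. \<bar>u y - u z\<bar> \<le> l * d y z" and "0 \<le> l" "l * b \<le> B" "0 < B"
    and F: "\<And>y. \<bar>u y\<bar> \<le> F"
    and "0 < h" "0 \<le> \<epsilon>" and err: "ennreal (exp (2 * F)) * rate_error h x \<le> ennreal \<epsilon>"
  shows "measure_pmf.expectation (law h x) (\<lambda>y. exp (u y))
    \<le> exp (semigroup_op M X h u x + h * ((exp B - 1 - B) / B\<^sup>2 * l\<^sup>2 * V\<^sup>2 + \<epsilon>))"
proof -
  define G where "G y = exp (u y - u x) - 1 - (u y - u x)" for y
  define c where "c = (exp B - 1 - B) / B\<^sup>2 * l\<^sup>2 * V\<^sup>2"
  have c: "0 \<le> c"
    unfolding c_def by (intro divide_nonneg_nonneg mult_nonneg_nonneg exp_remainder_nonneg) simp_all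
  have G0: "0 \<le> G y" for y
    by (simp only: G_def exp_remainder_nonneg)
  \<comment> \<open>A crude bound suffices, because it only multiplies the vanishing
    \<open>rate_error\<close>.\<close>
  have GB: "G y \<le> exp (2 * F)" for y
  proof -
    have v: "\<bar>u y - u x\<bar> \<le> 2 * F"
      using F[of y] F[of x] by linarith
    have "G y \<le> exp \<bar>u y - u x\<bar>"
    proof (cases "0 \<le> u y - u x")
      case False
      then have "exp (u y - u x) \<le> 1"
        by simp
      with False show ?thesis
        using exp_ge_add_one_self[of "\<bar>u y - u x\<bar>"] unfolding G_def by linarith
    qed (simp add: G_def)
    also have "\<dots> \<le> exp (2 * F)"
      using v by simp
    finally show ?thesis .
  qed
  have intG: "integrable (measure_pmf (law h x)) G"
    by (rule measure_pmf.integrable_const_bound[where B = "exp (2 * F)"]) (use G0 GB in auto)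
  have intu: "integrable (measure_pmf (law h x)) u"
    by (rule measure_pmf.integrable_const_bound[where B = F]) (use F in auto)
  have "ennreal (measure_pmf.expectation (law h x) G) = (\<integral>\<^sup>+y. ennreal (G y) \<partial>measure_pmf (law h x))"
    by (rule nn_integral_eq_integral[symmetric, OF intG]) (simp add: G0)
  also have "\<dots> \<le> ennreal h * ((\<integral>\<^sup>+y. ennreal (rate x y * G y) \<partial>count_space UNIV)
      + ennreal (exp (2 * F)) * rate_error h x)"
    by (rule nn_integral_law_le_rate[OF \<open>0 < h\<close> G0 GB]) (simp add: G_def)
  also have "\<dots> \<le> ennreal h * (ennreal c + ennreal \<epsilon>)"
    using nn_integral_rate_exp_remainder[OF assms(1-4)] err
    unfolding G_def c_def by (intro mult_left_mono add_mono) auto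
  also have "\<dots> = ennreal (h * (c + \<epsilon>))"
    using \<open>0 < h\<close> \<open>0 \<le> \<epsilon>\<close> c by (simp add: ennreal_mult[symmetric] ennreal_plus[symmetric] del: ennreal_plus)
  finally have EG: "measure_pmf.expectation (law h x) G \<le> h * (c + \<epsilon>)"
    using \<open>0 < h\<close> \<open>0 \<le> \<epsilon>\<close> c by (subst (asm) ennreal_le_iff) auto
  have "(\<lambda>y. exp (u y)) = (\<lambda>y. exp (u x) * (1 - u x + u y + G y))"
    by (simp add: G_def exp_diff fun_eq_iff)
  then have "measure_pmf.expectation (law h x) (\<lambda>y. exp (u y))
      = exp (u x) * (1 - u x + measure_pmf.expectation (law h x) u + measure_pmf.expectation (law h x) G)"
    using intG intu by simp
  also have "\<dots> \<le> exp (u x) * (1 + (semigroup_op M X h u x - u x + h * (c + \<epsilon>)))"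
    using EG \<open>0 < h\<close> by (simp add: expectation_law)
  also have "\<dots> \<le> exp (u x) * exp (semigroup_op M X h u x - u x + h * (c + \<epsilon>))"
    by (intro mult_left_mono exp_ge_add_one_self) simp
  also have "\<dots> = exp (semigroup_op M X h u x + h * (c + \<epsilon>))"
    by (simp add: mult_exp_exp)
  finally show ?thesis
    by (simp add: c_def)
qed

text \<open>The weights \<open>exp (P\<^bsub>(n-k)h\<^esub> f)\<close> turn the killed skeleton into an approximate
  supermartingale; killing on leaving the finite set \<open>S\<close> makes the error of a step uniform.\<close>

lemma killed_skeleton_exp_bound:
  assumes f: "\<And>y z. \<bar>f y - f z\<bar> \<le> L * d y z" and "0 \<le> L"
    and F: "\<And>y. \<bar>f y\<bar> \<le> F"
    and B: "\<And>r. 0 \<le> r \<Longrightarrow> r \<le> real n * h \<Longrightarrow> exp (- K * r) * L * b \<le> B" "0 < B"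
    and "0 < h" "0 \<le> \<epsilon>" "finite S"
    and err: "\<And>y. y \<in> S \<Longrightarrow> ennreal (exp (2 * F)) * rate_error h y \<le> ennreal \<epsilon>"
    and "k \<le> n"
  shows "(\<Sum>y\<in>S. skeleton_mass S h x k y * exp (semigroup_op M X (real (n - k) * h) f y))
    \<le> exp (semigroup_op M X (real n * h) f x
        + (\<Sum>j<k. h * ((exp B - 1 - B) / B\<^sup>2 * (exp (- K * (real (n - Suc j) * h)) * L)\<^sup>2 * V\<^sup>2 + \<epsilon>)))"
  using \<open>k \<le> n\<close>
proof (induction k)
  case 0
  have "(\<Sum>y\<in>S. skeleton_mass S h x 0 y * exp (semigroup_op M X (real n * h) f y))
      = (\<Sum>y\<in>S. if y = x then exp (semigroup_op M X (real n * h) f x) else 0)"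
    by (intro sum.cong) (auto simp: skeleton_mass_0)
  also have "\<dots> \<le> exp (semigroup_op M X (real n * h) f x)"
    using \<open>finite S\<close> by simp
  finally show ?case
    by simp
next
  case (Suc k)
  define r where "r = real (n - Suc k) * h"
  define l where "l = exp (- K * r) * L"
  define a where "a = h * ((exp B - 1 - B) / B\<^sup>2 * l\<^sup>2 * V\<^sup>2 + \<epsilon>)"
  let ?P = "\<lambda>s. semigroup_op M X s f"
  have r: "0 \<le> r" "r \<le> real n * h"
    using \<open>0 < h\<close> by (auto simp: r_def intro!: mult_right_mono)
  \<comment> \<open>Here \<open>r\<close> is the time left after the step and \<open>h + r\<close>
    the time left before it.\<close>
  have r_Suc: "h + r = real (n - k) * h"
    using Suc.prems by (simp add: r_def of_nat_diff algebra_simps)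
  have step: "(\<Sum>z\<in>S. pmf (law h y) z * exp (?P r z)) \<le> exp (?P (real (n - k) * h) y) * exp a"
    if "y \<in> S" for y
  proof -
    have P_le: "\<bar>?P r z\<bar> \<le> F" for z
      by (rule semigroup_op_bounded[OF r(1) F])
    have int: "integrable (measure_pmf (law h y)) (\<lambda>z. exp (?P r z))"
      using P_le by (intro measure_pmf.integrable_const_bound[where B = "exp F"]) (auto simp: abs_le_iff)
    have "(\<Sum>z\<in>S. pmf (law h y) z * exp (?P r z))
        = measure_pmf.expectation (law h y) (\<lambda>z. indicator S z * exp (?P r z))"
      using \<open>finite S\<close> by (subst integral_measure_pmf[of S]) (auto simp: indicator_def split: if_splits)
    also have "\<dots> \<le> measure_pmf.expectation (law h y) (\<lambda>z. exp (?P r z))"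
    proof (rule integral_mono[OF _ int])
      show "integrable (measure_pmf (law h y)) (\<lambda>z. indicator S z * exp (?P r z))"
        using P_le by (intro measure_pmf.integrable_const_bound[where B = "exp F"])
          (auto simp: abs_le_iff indicator_def)
    qed (simp add: indicator_def)
    also have "\<dots> \<le> exp (semigroup_op M X h (?P r) y + a)"
      unfolding a_def l_def
      by (rule expectation_exp_one_step[OF lipschitz_semigroup_op[OF f r(1)] _ _ \<open>0 < B\<close> P_le \<open>0 < h\<close> \<open>0 \<le> \<epsilon>\<close> err[OF that]])
        (use B(1)[OF r(1,2)] \<open>0 \<le> L\<close> in auto)
    \<comment> \<open>The semigroup property turns the exponent into the weight of the previous
      step, which closes the induction.\<close>
    also have "semigroup_op M X h (?P r) y = ?P (real (n - k) * h) y"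
      using semigroup_op_add[OF _ r(1) F, of h] \<open>0 < h\<close> r_Suc by simp
    finally show ?thesis
      by (simp add: exp_add)
  qed
  have "(\<Sum>z\<in>S. skeleton_mass S h x (Suc k) z * exp (?P r z))
      = (\<Sum>z\<in>S. \<Sum>y\<in>S. skeleton_mass S h x k y * (pmf (law h y) z * exp (?P r z)))"
    using \<open>0 < h\<close> \<open>finite S\<close> by (simp add: skeleton_mass_Suc sum_distrib_right mult.assoc)
  also have "\<dots> = (\<Sum>y\<in>S. skeleton_mass S h x k y * (\<Sum>z\<in>S. pmf (law h y) z * exp (?P r z)))"
    by (subst sum.swap) (simp add: sum_distrib_left)
  also have "\<dots> \<le> (\<Sum>y\<in>S. skeleton_mass S h x k y * (exp (?P (real (n - k) * h) y) * exp a))"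
    by (intro sum_mono mult_left_mono step skeleton_mass_nonneg)
  also have "\<dots> = (\<Sum>y\<in>S. skeleton_mass S h x k y * exp (?P (real (n - k) * h) y)) * exp a"
    by (simp add: sum_distrib_right mult.assoc)
  also have "\<dots> \<le> exp (?P (real n * h) x
      + (\<Sum>j<k. h * ((exp B - 1 - B) / B\<^sup>2 * (exp (- K * (real (n - Suc j) * h)) * L)\<^sup>2 * V\<^sup>2 + \<epsilon>))) * exp a"
    using Suc by (intro mult_right_mono) auto
  finally show ?case
    by (simp add: a_def l_def r_def mult_exp_exp add.assoc)
qed

text \<open>All meshes are tested at once, so the event does not change while the mesh is refined;
  as a countable intersection it is measurable. It contains every path that remains in
  \<open>S\<close> on \<open>[0, t]\<close>.\<close>

definition skeleton_stays :: "real \<Rightarrow> 'a set \<Rightarrow> 'a \<Rightarrow> 'w set" where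
  "skeleton_stays t S x =
     {\<omega> \<in> space (M x). \<forall>n>0. \<forall>j\<le>n. X (real j * (t / real n)) \<omega> \<in> S}"

lemma skeleton_stays_event:
  assumes "0 \<le> t"
  shows "skeleton_stays t S x \<in> sets (M x)"
  unfolding skeleton_stays_def
  by (intro sets.sets_Collect_countable_All sets.sets_Collect_imp sets.sets_Collect_const X_event)
    (use assms in auto)

text \<open>For fixed \<open>S\<close> and \<open>\<epsilon>\<close> the mesh tends to 0: the step
  errors add up to \<open>t * \<epsilon>\<close> and the quadratic terms form a Riemann sum with
  limit \<open>M_const t K\<close>. Then \<open>\<epsilon>\<close> tends to 0.\<close>

lemma integral_skeleton_stays_le:
  assumes f: "\<And>y z. \<bar>f y - f z\<bar> \<le> L * d y z" and "0 \<le> L"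
    and F: "\<And>y. \<bar>f y\<bar> \<le> F"
    and B: "\<And>r. 0 \<le> r \<Longrightarrow> r \<le> t \<Longrightarrow> exp (- K * r) * L * b \<le> B" "0 < B"
    and "0 < t" "finite S"
  shows "(LINT \<omega>|M x. indicator (skeleton_stays t S x) \<omega> * exp (f (X t \<omega>)))
    \<le> exp (semigroup_op M X t f x + (exp B - 1 - B) / B\<^sup>2 * (L\<^sup>2 * V\<^sup>2 * M_const t K))"
    (is "?I \<le> exp (?P + ?k * (L\<^sup>2 * V\<^sup>2 * _))")
proof -
  interpret prob_space "M x" by (rule prob_space_M)
  define R where "R n = (\<Sum>k<n. t / real n * exp (- 2 * K * (real k * (t / real n))))" for n :: nat
  have exp_F: "exp (f y) \<le> exp F" for y
    using F[of y] by (simp add: abs_le_iff)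
  have I_le: "?I \<le> exp (?P + (?k * (L\<^sup>2 * V\<^sup>2 * R n) + t * \<epsilon>))"
    if n: "0 < n" and "0 \<le> \<epsilon>"
      and err: "\<And>y. y \<in> S \<Longrightarrow> ennreal (exp (2 * F)) * rate_error (t / real n) y \<le> ennreal \<epsilon>" for n \<epsilon>
  proof -
    define h where "h = t / real n"
    have h: "0 < h" "real n * h = t"
      using n \<open>0 < t\<close> by (simp_all add: h_def)
    let ?D = "\<lambda>y. {\<omega> \<in> space (M x). X (real n * h) \<omega> = y \<and> (\<forall>j<n. X (real j * h) \<omega> \<in> S)}"
    have D: "?D y \<in> events" for y
      using h by (intro skeleton_events) simp
    have "?I \<le> (LINT \<omega>|M x. (\<Sum>y\<in>S. indicator (?D y) \<omega> * exp (f y)))"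
    proof (rule integral_mono)
      have "(\<lambda>\<omega>. exp (f (X t \<omega>))) \<in> borel_measurable (M x)"
        using measurable_compose[OF measurable_X[of t x], of "\<lambda>y. exp (f y)" borel] \<open>0 < t\<close> by simp
      then show "integrable (M x) (\<lambda>\<omega>. indicator (skeleton_stays t S x) \<omega> * exp (f (X t \<omega>)))"
        using skeleton_stays_event[of t S x] \<open>0 < t\<close> exp_F
        by (intro integrable_const_bound[where B = "exp F"]) (auto simp: indicator_def)
      show "integrable (M x) (\<lambda>\<omega>. \<Sum>y\<in>S. indicator (?D y) \<omega> * exp (f y))"
        using D by (intro Bochner_Integration.integrable_sum integrable_mult_left integrable_real_indicator)
          (auto simp: emeasure_eq_measure)
      fix \<omega>
      assume "\<omega> \<in> space (M x)"
      show "indicator (skeleton_stays t S x) \<omega> * exp (f (X t \<omega>)) \<le> (\<Sum>y\<in>S. indicator (?D y) \<omega> * exp (f y))"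
      proof (cases "\<omega> \<in> skeleton_stays t S x")
        case True
        then have stay: "\<forall>j\<le>n. X (real j * h) \<omega> \<in> S"
          using n by (auto simp: skeleton_stays_def h_def)
        then have XS: "X t \<omega> \<in> S"
          using h(2) by (metis order_refl)
        \<comment> \<open>Only the summand of the actual endpoint survives; the other states of
          \<open>S\<close> contribute nonnegative terms.\<close>
        have "exp (f (X t \<omega>)) = (\<Sum>y\<in>{X t \<omega>}. indicator (?D y) \<omega> * exp (f y))"
          using stay h(2) \<open>\<omega> \<in> space (M x)\<close> by (auto simp: indicator_def)
        also have "\<dots> \<le> (\<Sum>y\<in>S. indicator (?D y) \<omega> * exp (f y))"
          using XS \<open>finite S\<close> by (intro sum_mono2) auto
        finally show ?thesis
          using True by simp
      qed (simp add: sum_nonneg)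
    qed
    also have "\<dots> = (\<Sum>y\<in>S. skeleton_mass S h x n y * exp (semigroup_op M X (real (n - n) * h) f y))"
      using D by (subst Bochner_Integration.integral_sum)
        (auto simp: skeleton_mass_def semigroup_op_0 emeasure_eq_measure)
    also have "\<dots> \<le> exp (semigroup_op M X (real n * h) f x
        + (\<Sum>j<n. h * (?k * (exp (- K * (real (n - Suc j) * h)) * L)\<^sup>2 * V\<^sup>2 + \<epsilon>)))"
      by (rule killed_skeleton_exp_bound[OF f \<open>0 \<le> L\<close> F B(1) B(2) h(1) \<open>0 \<le> \<epsilon>\<close> \<open>finite S\<close>])
        (use err h(2) in \<open>auto simp: h_def\<close>)
    \<comment> \<open>Reversing the sum indexes the steps by the time remaining after them, as in
      \<open>R\<close>.\<close>
    also have "(\<Sum>j<n. h * (?k * (exp (- K * (real (n - Suc j) * h)) * L)\<^sup>2 * V\<^sup>2 + \<epsilon>))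
        = (\<Sum>j<n. h * (?k * (exp (- K * (real j * h)) * L)\<^sup>2 * V\<^sup>2 + \<epsilon>))"
      by (rule sum.nat_diff_reindex)
    also have "\<dots> = (\<Sum>j<n. ?k * (L\<^sup>2 * V\<^sup>2 * (h * exp (- 2 * K * (real j * h)))) + h * \<epsilon>)"
      by (intro sum.cong refl) (simp add: power_mult_distrib exp_of_nat_mult[symmetric] exp_double[symmetric] algebra_simps)
    also have "\<dots> = ?k * (L\<^sup>2 * V\<^sup>2 * R n) + t * \<epsilon>"
      using h(2) by (simp add: sum.distrib R_def h_def[symmetric] sum_distrib_left mult.assoc[symmetric])
    finally show ?thesis
      by (simp add: h(2))
  qed
  have I_le': "?I \<le> exp (?P + (?k * (L\<^sup>2 * V\<^sup>2 * M_const t K) + t * \<epsilon>))" if "0 < \<epsilon>" for \<epsilon>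
  proof (rule LIMSEQ_le_const)
    have "R \<longlonglongrightarrow> M_const t K"
      unfolding R_def by (rule geometric_riemann_sum) fact
    then show "(\<lambda>n. exp (?P + (?k * (L\<^sup>2 * V\<^sup>2 * R n) + t * \<epsilon>)))
        \<longlonglongrightarrow> exp (?P + (?k * (L\<^sup>2 * V\<^sup>2 * M_const t K) + t * \<epsilon>))"
      by (intro tendsto_intros)
    have "\<forall>\<^sub>F n in sequentially. \<forall>y\<in>S. ennreal (exp (2 * F)) * rate_error (t / real n) y \<le> ennreal \<epsilon>"
    proof (intro eventually_ball_finite[OF \<open>finite S\<close>] ballI)
      fix y
      \<comment> \<open>The index is shifted because \<open>rate_error_tendsto\<close> asks for
        positive steps throughout, while \<open>t / 0 = 0\<close>.\<close>
      have "(\<lambda>n. rate_error (t / real (Suc n)) y) \<longlonglongrightarrow> 0"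
        using \<open>0 < t\<close> LIMSEQ_Suc[OF lim_const_over_n[of t]] by (intro rate_error_tendsto) auto
      then have "(\<lambda>n. rate_error (t / real n) y) \<longlonglongrightarrow> 0"
        by (rule LIMSEQ_imp_Suc)
      then have "(\<lambda>n. ennreal (exp (2 * F)) * rate_error (t / real n) y) \<longlonglongrightarrow> ennreal (exp (2 * F)) * 0"
        by (intro ennreal_tendsto_cmult) auto
      then have "\<forall>\<^sub>F n in sequentially. ennreal (exp (2 * F)) * rate_error (t / real n) y < ennreal \<epsilon>"
        by (rule order_tendstoD(2)) (use that in simp)
      then show "\<forall>\<^sub>F n in sequentially. ennreal (exp (2 * F)) * rate_error (t / real n) y \<le> ennreal \<epsilon>"
        by eventually_elim simp
    qed
    then have "\<forall>\<^sub>F n in sequentially. ?I \<le> exp (?P + (?k * (L\<^sup>2 * V\<^sup>2 * R n) + t * \<epsilon>))"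
      using eventually_gt_at_top[of 0] by eventually_elim (use I_le that in auto)
    then show "\<exists>N. \<forall>n\<ge>N. ?I \<le> exp (?P + (?k * (L\<^sup>2 * V\<^sup>2 * R n) + t * \<epsilon>))"
      by (simp add: eventually_sequentially)
  qed
  show ?thesis
  \<comment> \<open>Letting \<open>\<epsilon>\<close> vanish is done for the logarithm, where the
    error is additive; this needs a positive integral.\<close>
  proof (cases "?I \<le> 0")
    case True
    then show ?thesis
      by (rule order_trans) simp
  next
    case False
    have "ln ?I \<le> ?P + ?k * (L\<^sup>2 * V\<^sup>2 * M_const t K)"
    proof (rule field_le_epsilon)
      fix e :: real
      assume "0 < e"
      with I_le'[of "e / t"] \<open>0 < t\<close> have "?I \<le> exp (?P + ?k * (L\<^sup>2 * V\<^sup>2 * M_const t K) + e)"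
        by (simp add: add.assoc)
      then have "ln ?I \<le> ln (exp (?P + ?k * (L\<^sup>2 * V\<^sup>2 * M_const t K) + e))"
        using False by (subst ln_le_cancel_iff) auto
      then show "ln ?I \<le> ?P + ?k * (L\<^sup>2 * V\<^sup>2 * M_const t K) + e"
        by simp
    qed
    then show ?thesis
      using False by (metis exp_le_cancel_iff exp_ln not_le)
  qed
qed

text \<open>Almost every path visits finitely many states up to time \<open>t\<close>, hence
  eventually lies in \<open>skeleton_stays t (S N) x\<close>. Dominated convergence with the
  constant \<open>exp F\<close> removes the killing.\<close>

lemma expectation_exp_bounded_le:
  assumes f: "\<And>y z. \<bar>f y - f z\<bar> \<le> L * d y z" and "0 \<le> L"
    and F: "\<And>y. \<bar>f y\<bar> \<le> F"
    and B: "\<And>r. 0 \<le> r \<Longrightarrow> r \<le> t \<Longrightarrow> exp (- K * r) * L * b \<le> B" "0 < B"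
    and "0 < t"
  shows "(LINT \<omega>|M x. exp (f (X t \<omega>)))
    \<le> exp (semigroup_op M X t f x + (exp B - 1 - B) / B\<^sup>2 * (L\<^sup>2 * V\<^sup>2 * M_const t K))"
proof -
  interpret prob_space "M x" by (rule prob_space_M)
  define S where "S N = {y :: 'a. to_nat y < N}" for N
  have S: "finite (S N)" for N
    unfolding S_def by (rule finite_subset[of _ "to_nat -` {..<N}"]) (auto intro: finite_vimageI)
  let ?A = "\<lambda>N. skeleton_stays t (S N) x"
  have meas: "(\<lambda>\<omega>. exp (f (X t \<omega>))) \<in> borel_measurable (M x)"
    using measurable_compose[OF measurable_X[of t x], of "\<lambda>y. exp (f y)" borel] \<open>0 < t\<close> by simp
  have exp_F: "exp (f y) \<le> exp F" for y
    using F[of y] by (simp add: abs_le_iff)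
  have "(\<lambda>N. LINT \<omega>|M x. indicator (?A N) \<omega> * exp (f (X t \<omega>))) \<longlonglongrightarrow> (LINT \<omega>|M x. exp (f (X t \<omega>)))"
  proof (rule integral_dominated_convergence[where w = "\<lambda>_. exp F"])
    show "(\<lambda>\<omega>. indicator (?A N) \<omega> * exp (f (X t \<omega>))) \<in> borel_measurable (M x)" for N
      using meas skeleton_stays_event[of t "S N" x] \<open>0 < t\<close> by auto
    show "AE \<omega> in M x. norm (indicator (?A N) \<omega> * exp (f (X t \<omega>))) \<le> exp F" for N
      using exp_F by (auto simp: indicator_def)
    show "AE \<omega> in M x. (\<lambda>N. indicator (?A N) \<omega> * exp (f (X t \<omega>))) \<longlonglongrightarrow> exp (f (X t \<omega>))"
      using nonexplosive AE_space
    proof eventually_elim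
      case (elim \<omega>)
      have "finite (to_nat ` (\<lambda>s. X s \<omega>) ` {0..t})"
        using step_path_finite_range[OF elim(1)] by blast
      then obtain N0 where N0: "\<forall>s\<in>{0..t}. to_nat (X s \<omega>) < N0"
        unfolding finite_nat_set_iff_bounded by auto
      have "\<omega> \<in> ?A N" if "N0 \<le> N" for N
        unfolding skeleton_stays_def
      proof (intro CollectI conjI allI impI)
        fix n j :: nat
        assume "0 < n" "j \<le> n"
        then have "real j * (t / real n) \<in> {0..t}"
          using \<open>0 < t\<close> by (auto simp: field_simps)
        then show "X (real j * (t / real n)) \<omega> \<in> S N"
          using N0 that by (force simp: S_def)
      qed (rule elim(2))
      then show ?case
        by (intro tendsto_eventually eventually_sequentiallyI[of N0]) simp
    qed
  qed (use meas in auto)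
  then show ?thesis
    by (rule LIMSEQ_le_const2)
      (use integral_skeleton_stays_le[OF f \<open>0 \<le> L\<close> F B \<open>0 < t\<close> S] in auto)
qed

end

section \<open>The deviation inequality\<close>

text \<open>Fatou's lemma, in the form used to pass from truncations to the full function.\<close>

lemma nn_integral_le_of_tendsto:
  assumes "\<And>n. u n \<in> borel_measurable N"
    and "\<And>z. (\<lambda>n. u n z) \<longlonglongrightarrow> v z"
    and "\<And>n. (\<integral>\<^sup>+z. u n z \<partial>N) \<le> C n" and "C \<longlonglongrightarrow> c"
  shows "(\<integral>\<^sup>+z. v z \<partial>N) \<le> (c :: ennreal)"
proof -
  have "v z = liminf (\<lambda>n. u n z)" for z
    using assms(2)[of z] by (simp add: lim_imp_Liminf)
  then have "(\<integral>\<^sup>+z. v z \<partial>N) = (\<integral>\<^sup>+z. liminf (\<lambda>n. u n z) \<partial>N)"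
    by simp
  also have "\<dots> \<le> liminf (\<lambda>n. \<integral>\<^sup>+z. u n z \<partial>N)"
    by (rule nn_integral_liminf) (rule assms(1))
  also have "\<dots> \<le> liminf C"
    by (rule Liminf_mono) (simp add: assms(3))
  also have "\<dots> = c"
    using assms(4) by (simp add: lim_imp_Liminf)
  finally show ?thesis .
qed

section \<open>Truncation and the passage to unbounded Lipschitz functions\<close>

definition truncate :: "nat \<Rightarrow> real \<Rightarrow> real" where
  "truncate n v = max (- real n) (min (real n) v)"

lemma truncate_bounded: "\<bar>truncate n v\<bar> \<le> real n"
  by (auto simp: truncate_def)

lemma truncate_contraction: "\<bar>truncate n v - truncate n w\<bar> \<le> \<bar>v - w\<bar>"
  by (auto simp: truncate_def max_def min_def)

lemma abs_truncate_le: "\<bar>truncate n v\<bar> \<le> \<bar>v\<bar>"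
  by (auto simp: truncate_def max_def min_def)

lemma truncate_tendsto: "(\<lambda>n. truncate n v) \<longlonglongrightarrow> v"
proof (rule tendsto_eventually, rule eventually_sequentiallyI)
  fix n
  assume "nat \<lceil>\<bar>v\<bar>\<rceil> \<le> n"
  then have "\<bar>v\<bar> \<le> real n"
    by linarith
  then show "truncate n v = v"
    by (auto simp: truncate_def)
qed

context curved_chain
begin

text \<open>The moment condition concerns one starting state \<open>x0\<close>. Applied to truncated
  distances, the contraction carries it to \<open>x\<close> at the cost of
  \<open>exp (- K * t) * d x x0\<close>, uniformly in the truncation level, and Fatou's lemma
  concludes.\<close>

lemma nn_integral_dist_finite:
  assumes "0 < t"
  shows "\<exists>z. (\<integral>\<^sup>+y. ennreal (d y z) \<partial>measure_pmf (law t x)) < \<infinity>"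
proof -
  have pmf_eq: "measure (trans_law M X t x') {y} = pmf (law t x') y" for x' y
    using assms by (simp add: pmf.rep_eq measure_pmf_law trans_law_def)
  obtain x0 where "trans_law M X t x0 \<in> P1 d"
    using curvature assms unfolding wasserstein_curvature_ge_def by blast
  then obtain z where "(\<lambda>y. d y z * pmf (law t x0) y) summable_on UNIV"
    unfolding P1_def by (auto simp: pmf_eq)
  then have "(\<lambda>y. norm (d y z * pmf (law t x0) y)) summable_on UNIV"
    by (simp add: dist_nonneg)
  then have "Infinite_Set_Sum.abs_summable_on (\<lambda>y. d y z * pmf (law t x0) y) UNIV"
    by (simp only: abs_summable_equivalent)
  then have int: "integrable (count_space UNIV) (\<lambda>y. d y z * pmf (law t x0) y)"
    by (simp add: abs_summable_on_def)
  have "(\<integral>\<^sup>+y. ennreal (d y z) \<partial>measure_pmf (law t x0))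
      = (\<integral>\<^sup>+y. ennreal (d y z * pmf (law t x0) y) \<partial>count_space UNIV)"
    by (simp add: nn_integral_measure_pmf dist_nonneg ennreal_mult mult.commute)
  also have "\<dots> = ennreal (LINT y|count_space UNIV. d y z * pmf (law t x0) y)"
    by (rule nn_integral_eq_integral[OF int]) (simp add: dist_nonneg)
  finally have fin: "(\<integral>\<^sup>+y. ennreal (d y z) \<partial>measure_pmf (law t x0)) < \<infinity>"
    by simp
  have dist_int: "integrable (measure_pmf (law t x0)) (\<lambda>y. d y z)"
    by (rule integrableI_bounded) (use fin in \<open>simp_all add: dist_nonneg\<close>)
  define C where "C = measure_pmf.expectation (law t x0) (\<lambda>y. d y z) + exp (- K * t) * d x x0"
  define g where "g n y = truncate n (d y z)" for n y
  have g_lip: "\<bar>g n y - g n w\<bar> \<le> 1 * d y w" for n y w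
  proof -
    interpret Metric_space UNIV d by (rule metric)
    have "\<bar>d y z - d w z\<bar> \<le> d y w"
      using triangle[of y w z] triangle[of w y z] commute[of w y] by simp
    then show ?thesis
      using truncate_contraction[of n "d y z" "d w z"] by (simp add: g_def)
  qed
  have g_bdd: "\<bar>g n y\<bar> \<le> real n" for n y
    by (simp add: g_def truncate_bounded)
  have g_nonneg: "0 \<le> g n y" for n y
    using dist_nonneg[of y z] by (simp add: g_def truncate_def)
  have g_int: "integrable (measure_pmf (law t w)) (g n)" for n w
    by (rule measure_pmf.integrable_const_bound[where B = "real n"]) (use g_bdd in auto)
  have g_le: "(\<integral>\<^sup>+y. ennreal (g n y) \<partial>measure_pmf (law t x)) \<le> ennreal C" for n
  proof -
    have "measure_pmf.expectation (law t x) (g n)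
        \<le> measure_pmf.expectation (law t x0) (g n) + exp (- K * t) * 1 * d x x0"
      using lipschitz_semigroup_op[OF g_lip, of t n x x0] assms by (simp add: expectation_law abs_le_iff)
    moreover have "measure_pmf.expectation (law t x0) (g n) \<le> measure_pmf.expectation (law t x0) (\<lambda>y. d y z)"
    proof (rule integral_mono[OF g_int dist_int])
      show "g n y \<le> d y z" for y
        using abs_truncate_le[of n "d y z"] dist_nonneg[of y z] unfolding g_def by linarith
    qed
    ultimately have "measure_pmf.expectation (law t x) (g n) \<le> C"
      by (simp add: C_def)
    then show ?thesis
      using g_nonneg by (simp add: nn_integral_eq_integral[OF g_int] ennreal_leI)
  qed
  have "(\<integral>\<^sup>+y. ennreal (d y z) \<partial>measure_pmf (law t x)) \<le> ennreal C"
    by (rule nn_integral_le_of_tendsto[OF _ _ g_le tendsto_const])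
      (auto simp: g_def intro!: tendsto_ennrealI truncate_tendsto)
  then show ?thesis
    using order_le_less_trans[OF _ ennreal_less_top] by auto
qed

lemma integrable_law_lipschitz:
  assumes f: "\<And>y z. \<bar>f y - f z\<bar> \<le> L * d y z" and "0 < t"
  shows "integrable (measure_pmf (law t x)) f"
proof -
  obtain z where z: "(\<integral>\<^sup>+y. ennreal (d y z) \<partial>measure_pmf (law t x)) < \<infinity>"
    using nn_integral_dist_finite[OF \<open>0 < t\<close>] by blast
  have "integrable (measure_pmf (law t x)) (\<lambda>y. d y z)"
    by (rule integrableI_bounded) (use z in \<open>simp_all add: dist_nonneg\<close>)
  then have "integrable (measure_pmf (law t x)) (\<lambda>y. \<bar>f z\<bar> + L * d y z)"
    by simp
  then show ?thesis
  proof (rule Bochner_Integration.integrable_bound)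
    show "AE y in measure_pmf (law t x). norm (f y) \<le> norm (\<bar>f z\<bar> + L * d y z)"
    proof (rule AE_I2)
      fix y
      show "norm (f y) \<le> norm (\<bar>f z\<bar> + L * d y z)"
        using f[of y z] by simp
    qed
  qed simp
qed

text \<open>Truncation keeps the Lipschitz constant, so the bounded case applies to \<open>l\<close>
  times each truncation. The centering converges by dominated convergence, since \<open>f\<close> is
  integrable, and Fatou's lemma handles the exponential.\<close>

lemma nn_integral_exp_centered_le:
  assumes f: "\<And>y z. \<bar>f y - f z\<bar> \<le> L * d y z" and "0 < L" and "0 < t" and "0 < l"
  defines "B \<equiv> b * C_const t K * L"
  shows "(\<integral>\<^sup>+y. ennreal (exp (l * (f y - semigroup_op M X t f x))) \<partial>measure_pmf (law t x))
    \<le> ennreal (exp ((exp (l * B) - 1 - l * B) / B\<^sup>2 * (L\<^sup>2 * V\<^sup>2 * M_const t K)))"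
proof -
  have C_pos: "0 < C_const t K"
    using exp_le_C_const[of 0 t K] \<open>0 < t\<close> by simp
  then have B_pos: "0 < B"
    using b_pos \<open>0 < L\<close> by (simp add: B_def)
  define F where "F n y = l * truncate n (f y)" for n y
  define c where "c = (exp (l * B) - 1 - l * B) / B\<^sup>2 * (L\<^sup>2 * V\<^sup>2 * M_const t K)"
  have F_lip: "\<bar>F n y - F n z\<bar> \<le> (l * L) * d y z" for n y z
  proof -
    have "\<bar>F n y - F n z\<bar> = l * \<bar>truncate n (f y) - truncate n (f z)\<bar>"
      using \<open>0 < l\<close> by (simp add: F_def abs_mult right_diff_distrib[symmetric])
    also have "\<dots> \<le> l * (L * d y z)"
      using \<open>0 < l\<close> order_trans[OF truncate_contraction f] by (intro mult_left_mono) auto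
    finally show ?thesis
      by (simp add: mult.assoc)
  qed
  have F_bdd: "\<bar>F n y\<bar> \<le> l * real n" for n y
    using \<open>0 < l\<close> truncate_bounded[of n "f y"] by (simp add: F_def abs_mult)
  have F_lim: "(\<lambda>n. F n y) \<longlonglongrightarrow> l * f y" for y
    unfolding F_def by (intro tendsto_intros truncate_tendsto)
  have PF_lim: "(\<lambda>n. semigroup_op M X t (F n) x) \<longlonglongrightarrow> l * semigroup_op M X t f x"
  proof -
    have "(\<lambda>n. measure_pmf.expectation (law t x) (F n)) \<longlonglongrightarrow> measure_pmf.expectation (law t x) (\<lambda>y. l * f y)"
    proof (rule integral_dominated_convergence[where w = "\<lambda>y. l * \<bar>f y\<bar>"])
      show "integrable (measure_pmf (law t x)) (\<lambda>y. l * \<bar>f y\<bar>)"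
        using integrable_law_lipschitz[OF f \<open>0 < t\<close>] by simp
      show "AE y in measure_pmf (law t x). norm (F n y) \<le> l * \<bar>f y\<bar>" for n
        using \<open>0 < l\<close> abs_truncate_le by (simp add: F_def abs_mult)
    qed (use F_lim in auto)
    then show ?thesis
      using \<open>0 < t\<close> by (simp add: expectation_law)
  qed
  have bound: "(\<integral>\<^sup>+y. ennreal (exp (F n y - semigroup_op M X t (F n) x)) \<partial>measure_pmf (law t x)) \<le> ennreal (exp c)" for n
  proof -
    \<comment> \<open>Up to time \<open>t\<close> the factor \<open>exp (- K * r)\<close> is at most
      \<open>C_const t K\<close>; this is how that constant enters \<open>B\<close>.\<close>
    have "exp (- K * r) * (l * L) * b \<le> l * B" if "0 \<le> r" "r \<le> t" for r
      using mult_left_mono[OF exp_le_C_const[OF that, of K], of "l * L * b"] \<open>0 < l\<close> \<open>0 < L\<close> b_pos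
      by (simp add: B_def mult_ac)
    from expectation_exp_bounded_le[OF F_lip[of n] _ F_bdd[of n] this _ \<open>0 < t\<close>, of x] \<open>0 < l\<close> \<open>0 < L\<close> B_pos
    have "(LINT \<omega>|M x. exp (F n (X t \<omega>)))
        \<le> exp (semigroup_op M X t (F n) x + (exp (l * B) - 1 - l * B) / (l * B)\<^sup>2 * ((l * L)\<^sup>2 * V\<^sup>2 * M_const t K))"
      by simp
    also have "(exp (l * B) - 1 - l * B) / (l * B)\<^sup>2 * ((l * L)\<^sup>2 * V\<^sup>2 * M_const t K) = c"
      using \<open>0 < l\<close> by (simp add: c_def power_mult_distrib)
    finally have le: "measure_pmf.expectation (law t x) (\<lambda>y. exp (F n y)) \<le> exp (semigroup_op M X t (F n) x + c)"
      using \<open>0 < t\<close> by (simp add: expectation_law semigroup_op_def)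
    have int: "integrable (measure_pmf (law t x)) (\<lambda>y. exp (F n y))"
      by (rule measure_pmf.integrable_const_bound[where B = "exp (l * real n)"])
        (use F_bdd in \<open>auto simp: abs_le_iff\<close>)
    have "(\<integral>\<^sup>+y. ennreal (exp (F n y - semigroup_op M X t (F n) x)) \<partial>measure_pmf (law t x))
        = ennreal (measure_pmf.expectation (law t x) (\<lambda>y. exp (F n y - semigroup_op M X t (F n) x)))"
      using int by (intro nn_integral_eq_integral) (auto simp: exp_diff)
    also have "\<dots> \<le> ennreal (exp c)"
      using le by (intro ennreal_leI) (simp add: exp_diff exp_add field_simps)
    finally show ?thesis .
  qed
  have "(\<integral>\<^sup>+y. ennreal (exp (l * f y - l * semigroup_op M X t f x)) \<partial>measure_pmf (law t x)) \<le> ennreal (exp c)"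
  proof (rule nn_integral_le_of_tendsto[OF _ _ bound tendsto_const])
    show "(\<lambda>n. ennreal (exp (F n z - semigroup_op M X t (F n) x)))
        \<longlonglongrightarrow> ennreal (exp (l * f z - l * semigroup_op M X t f x))" for z
      by (intro tendsto_ennrealI tendsto_exp tendsto_diff F_lim PF_lim)
  qed simp
  then show ?thesis
    by (simp add: c_def right_diff_distrib)
qed

text \<open>Markov's inequality for the exponential of \<open>l\<close> times the centered function,
  with Bennett's exponent \<open>l\<close> for the jump size \<open>B\<close> and the variance proxy
  \<open>v\<close>.\<close>

lemma deviation_inequality:
  assumes f: "f \<in> Lip d" and V: "V\<^sup>2 > 0" and t: "0 < t" and y: "0 < y"
  shows "measure_pmf.prob (law t x) {z. y \<le> f z - semigroup_op M X t f x}
    \<le> deviation_bound b V (C_const t K) (M_const t K) (lip_norm d f) y"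
proof -
  define L where "L = lip_norm d f"
  have f_lip: "\<bar>f z - f w\<bar> \<le> L * d z w" for z w
    unfolding L_def by (rule Lip_bound[OF metric f])
  have "0 \<le> L"
    unfolding L_def by (rule lip_norm_nonneg[OF metric f two_states])
  show ?thesis
  proof (cases "L = 0")
    case True
    \<comment> \<open>A constant \<open>f\<close> never deviates by \<open>y > 0\<close>, so the
      event is empty, in accordance with the value 0 of \<open>deviation_bound\<close>.\<close>
    then have "f z = f x" for z
      using f_lip[of z x] by simp
    then obtain k where k: "f = (\<lambda>_. k)"
      by blast
    have "semigroup_op M X t f x = k"
      using t by (simp add: k expectation_law[symmetric])
    then show ?thesis
      using y True by (simp add: k deviation_bound_def L_def)
  next
    case False
    with \<open>0 \<le> L\<close> have L: "0 < L"
      by simp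
    define B where "B = b * C_const t K * L"
    define v where "v = L\<^sup>2 * V\<^sup>2 * M_const t K"
    define l where "l = ln (1 + B * y / v) / B"
    have B: "0 < B"
      using b_pos L exp_le_C_const[of 0 t K] t by (simp add: B_def)
    have v: "0 < v"
      using L V M_const_pos[OF t, of K] by (simp add: v_def)
    have l: "0 < l"
      unfolding l_def using B v y by (intro divide_pos_pos ln_gt_zero) simp_all
    let ?A = "{z. y \<le> f z - semigroup_op M X t f x}"
    have "emeasure (measure_pmf (law t x)) ?A
        = (\<integral>\<^sup>+z. indicator ?A z \<partial>measure_pmf (law t x))"
      by simp
    also have "\<dots> \<le> (\<integral>\<^sup>+z. ennreal (exp (- (l * y))) * ennreal (exp (l * (f z - semigroup_op M X t f x))) \<partial>measure_pmf (law t x))"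
    proof (rule nn_integral_mono)
      fix z
      show "indicator ?A z \<le> ennreal (exp (- (l * y))) * ennreal (exp (l * (f z - semigroup_op M X t f x)))"
      proof (cases "z \<in> ?A")
        case True
        then have "0 \<le> - (l * y) + l * (f z - semigroup_op M X t f x)"
          using mult_left_mono[of y "f z - semigroup_op M X t f x" l] l by simp
        then have "1 \<le> exp (- (l * y) + l * (f z - semigroup_op M X t f x))"
          by simp
        then show ?thesis
          using True by (simp add: ennreal_mult[symmetric] mult_exp_exp)
      qed simp
    qed
    also have "\<dots> \<le> ennreal (exp (- (l * y))) * ennreal (exp ((exp (l * B) - 1 - l * B) / B\<^sup>2 * v))"
      using mult_left_mono[OF nn_integral_exp_centered_le[OF f_lip L t l, of x], of "ennreal (exp (- (l * y)))"]
      by (simp add: nn_integral_cmult B_def v_def)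
    also have "\<dots> = ennreal (exp ((exp (l * B) - 1 - l * B) / B\<^sup>2 * v - l * y))"
      by (simp add: ennreal_mult[symmetric] mult_exp_exp)
    also have "\<dots> \<le> ennreal (exp (- (y / (2 * B)) * ln (1 + B * y / v)))"
      using bennett_exponent[OF B v y] by (intro ennreal_leI) (simp add: l_def)
    finally have "measure_pmf.prob (law t x) ?A \<le> exp (- (y / (2 * B)) * ln (1 + B * y / v))"
      by (simp add: measure_pmf.emeasure_eq_measure)
    \<comment> \<open>One of the two factors \<open>L\<close> in \<open>v\<close> cancels against
      the one in \<open>B\<close>.\<close>
    also have "B * y / v = b * C_const t K * y / (M_const t K * V\<^sup>2 * L)"
      using L by (simp add: B_def v_def power2_eq_square mult_ac)
    finally show ?thesis
      using False by (simp add: deviation_bound_def B_def L_def mult.assoc)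
  qed
qed

end

theorem theorem3p1:
  fixes d :: "'a::countable \<Rightarrow> 'a \<Rightarrow> real"
    and M :: "'a \<Rightarrow> 'w measure"
    and X :: "real \<Rightarrow> 'w \<Rightarrow> 'a"
    and Q :: "'a \<Rightarrow> 'a \<Rightarrow> real"
    and b V K t y :: real
    and f :: "'a \<Rightarrow> real"
    and x :: 'a
  assumes "Metric_space UNIV d"
    and "d \<noteq> (\<lambda>x y. of_bool (x \<noteq> y))"
    and "regular_nonexplosive_chain M X Q"
    and "b > 0" and "jumps_bounded d M X b"
    and "V\<^sup>2 > 0" and "angle_bracket_bounded d Q V"
    and "wasserstein_curvature_ge d M X K"
    and "f \<in> Lip d"
    and "t > 0" and "y > 0"
  shows "\<P>(\<omega> in M x. f (X t \<omega>) - (LINT \<omega>'|M x. f (X t \<omega>')) \<ge> y)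
    \<le> deviation_bound b V (C_const t K) (M_const t K) (lip_norm d f) y"
proof -
  \<comment> \<open>On a single point every metric is the trivial one.\<close>
  have two_states: "\<exists>x y :: 'a. x \<noteq> y"
  proof (rule ccontr)
    assume "\<not> (\<exists>x y :: 'a. x \<noteq> y)"
    then have eq: "x = y" for x y :: 'a
      by blast
    have "d x y = of_bool (x \<noteq> y)" for x y
      using Metric_space.mdist_zero[OF assms(1), of x] eq[of x y] by simp
    then have "d = (\<lambda>x y. of_bool (x \<noteq> y))"
      by (intro ext)
    with assms(2) show False ..
  qed
  interpret curved_chain M X Q d b V K
    by (intro curved_chain.intro curved_chain_axioms.intro) fact+
  let ?A = "{z. y \<le> f z - semigroup_op M X t f x}"
  have "measure_pmf.prob (law t x) ?A = measure (distr (M x) (count_space UNIV) (X t)) ?A"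
    using \<open>t > 0\<close> by (simp add: measure_pmf_law)
  also have "\<dots> = measure (M x) (X t -` ?A \<inter> space (M x))"
    by (rule measure_distr) (use measurable_X[of t x] \<open>t > 0\<close> in auto)
  also have "X t -` ?A \<inter> space (M x)
      = {\<omega> \<in> space (M x). f (X t \<omega>) - (LINT \<omega>'|M x. f (X t \<omega>')) \<ge> y}"
    by (auto simp: semigroup_op_def)
  finally show ?thesis
    using deviation_inequality[OF \<open>f \<in> Lip d\<close> \<open>V\<^sup>2 > 0\<close> \<open>t > 0\<close> \<open>y > 0\<close>, of x] by simp
qed

end
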